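(* Let $f(x)=\tfrac12x'Qx+q'x$ be strongly convex quadratic (i.e. $\mu_f>0$), let $0<\gamma<1/L_f$, let $\lambda_k=(1-\gamma L_f)/(1+\gamma L_f)$ for all $k$, and let $$\beta_k=\frac{1-\sqrt{\mu_h/L_h}}{1+\sqrt{\mu_h/L_h}}\quad\text{for all }k.$$ Let $u^0=x^0\in\mathbb{R}^n$ and let the sequences be generated, for $k\ge0$, by $$y^k=\mathrm{prox}_{\gamma f}(u^k),\quad z^k=\mathrm{prox}_{\gamma g}(2y^k-u^k),\quad x^{k+1}=u^k+\lambda_k(z^k-y^k),\quad u^{k+1}=x^{k+1}+\beta_k(x^{k+1}-x^k).$$ Then for $\tilde x\in\tilde X$ and every $k\ge0$, $$F(z^k)-F_\star\le\frac{L_h}{\lambda_{\min}(D)}\left(1-\sqrt{\frac{\mu_h}{L_h}}\right)^k\|x^0-\tilde x\|^2.$$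
   Context: $Q\in\mathbb{R}^{n\times n}$ is symmetric positive semidefinite, $q\in\mathbb{R}^n$, $\mu_f=\lambda_{\min}(Q)$, $L_f=\lambda_{\max}(Q)$. Let $g:\mathbb{R}^n\to\mathbb{R}\cup\{+\infty\}$ be proper, closed and convex. Put $F=f+g$, assume that the set of minimizers of $F$ is nonempty, and let $F_\star=\min F$. For $\gamma>0$ and a proper closed convex function $h$, $\mathrm{prox}_{\gamma h}(x)=\arg\min_z\{h(z)+\tfrac{1}{2\gamma}\|z-x\|^2\}$. The set $\tilde X$ is the set of $x\in\mathbb{R}^n$ with $\mathrm{prox}_{\gamma g}(2\,\mathrm{prox}_{\gamma f}(x)-x)=\mathrm{prox}_{\gamma f}(x)$; the minimizers of $F$ are exactly the points $\mathrm{prox}_{\gamma f}(\tilde x)$, $\tilde x\in\tilde X$. Define the positive definite matrix $D=\gamma(2(I+\gamma Q)^{-1}-I)^{-1}$, whose smallest eigenvalue is $\lambda_{\min}(D)=\gamma\frac{1+\gamma\mu_f}{1-\gamma\mu_f}$, and the constants $$\mu_h=\lambda_{\min}(D)\,\min\left\{\frac{(1-\gamma\mu_f)\mu_f}{(1+\gamma\mu_f)^2},\frac{(1-\gamma L_f)L_f}{(1+\gamma L_f)^2}\right\},\qquad L_h=\frac{1+\gamma L_f}{1-\gamma L_f}.$$ *)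

theory Defs
  imports "HOL-Analysis.Analysis"
begin

definition eigenvalues :: "real^'n^'n \<Rightarrow> real set" where
  "eigenvalues A = {l. \<exists>v. v \<noteq> 0 \<and> A *v v = l *\<^sub>R v}"

text \<open>Only used for symmetric matrices, whose set of real eigenvalues is finite and nonempty,
  so that \<^const>\<open>Min\<close> and \<^const>\<open>Max\<close> are meaningful.\<close>

definition lambda_min :: "real^'n^'n \<Rightarrow> real" where
  "lambda_min A = Min (eigenvalues A)"

definition lambda_max :: "real^'n^'n \<Rightarrow> real" where
  "lambda_max A = Max (eigenvalues A)"

definition symmetric_matrix :: "real^'n^'n \<Rightarrow> bool" where
  "symmetric_matrix A \<longleftrightarrow> transpose A = A"

definition pos_semidef :: "real^'n^'n \<Rightarrow> bool" where
  "pos_semidef A \<longleftrightarrow> (\<forall>x. 0 \<le> x \<bullet> (A *v x))"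

definition quadratic :: "real^'n^'n \<Rightarrow> real^'n \<Rightarrow> real^'n \<Rightarrow> real" where
  "quadratic Q q x = 1/2 * (x \<bullet> (Q *v x)) + q \<bullet> x"

text \<open>Extended-valued convex functions, in the sense of convex analysis: a function is convex
  (closed) iff its epigraph is. The library's \<^const>\<open>epigraph\<close> and \<^const>\<open>convex_on\<close> cover only
  real-valued functions.\<close>

definition ereal_epigraph :: "('a \<Rightarrow> ereal) \<Rightarrow> ('a \<times> real) set" where
  "ereal_epigraph h = {(x, t). h x \<le> ereal t}"

definition proper_fun :: "('a \<Rightarrow> ereal) \<Rightarrow> bool" where
  "proper_fun h \<longleftrightarrow> (\<forall>x. h x \<noteq> -\<infinity>) \<and> (\<exists>x. h x \<noteq> \<infinity>)"

definition closed_fun :: "('a::topological_space \<Rightarrow> ereal) \<Rightarrow> bool" where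
  "closed_fun h \<longleftrightarrow> closed (ereal_epigraph h)"

definition convex_fun :: "('a::real_vector \<Rightarrow> ereal) \<Rightarrow> bool" where
  "convex_fun h \<longleftrightarrow> convex (ereal_epigraph h)"

definition minimizers :: "('a \<Rightarrow> ereal) \<Rightarrow> 'a set" where
  "minimizers h = {x. is_arg_min h (\<lambda>_. True) x}"

text \<open>The infimum, which is the minimum as soon as \<^term>\<open>minimizers h \<noteq> {}\<close>.\<close>

definition min_value :: "('a \<Rightarrow> ereal) \<Rightarrow> ereal" where
  "min_value h = (INF x. h x)"

text \<open>For \<^term>\<open>\<gamma> > 0\<close> and proper, closed, convex \<^term>\<open>h\<close> the minimizer exists and is unique, so the
  choice made by \<^const>\<open>arg_min\<close> is immaterial.\<close>

definition prox :: "real \<Rightarrow> ('a::real_normed_vector \<Rightarrow> ereal) \<Rightarrow> 'a \<Rightarrow> 'a" where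
  "prox \<gamma> h x = arg_min (\<lambda>z. h z + ereal (1 / (2 * \<gamma>) * (norm (z - x))\<^sup>2)) (\<lambda>_. True)"

definition DR_fixed_points ::
  "real \<Rightarrow> ('a::real_normed_vector \<Rightarrow> ereal) \<Rightarrow> ('a \<Rightarrow> ereal) \<Rightarrow> 'a set" where
  "DR_fixed_points \<gamma> f g = {x. prox \<gamma> g (2 *\<^sub>R prox \<gamma> f x - x) = prox \<gamma> f x}"

definition D_matrix :: "real^'n^'n \<Rightarrow> real \<Rightarrow> real^'n^'n" where
  "D_matrix Q \<gamma> = \<gamma> *\<^sub>R matrix_inv (2 *\<^sub>R matrix_inv (mat 1 + \<gamma> *\<^sub>R Q) - mat 1)"

definition mu_h :: "real^'n^'n \<Rightarrow> real \<Rightarrow> real" where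
  "mu_h Q \<gamma> = lambda_min (D_matrix Q \<gamma>) *
     min ((1 - \<gamma> * lambda_min Q) * lambda_min Q / (1 + \<gamma> * lambda_min Q)\<^sup>2)
         ((1 - \<gamma> * lambda_max Q) * lambda_max Q / (1 + \<gamma> * lambda_max Q)\<^sup>2)"

definition L_h :: "real^'n^'n \<Rightarrow> real \<Rightarrow> real" where
  "L_h Q \<gamma> = (1 + \<gamma> * lambda_max Q) / (1 - \<gamma> * lambda_max Q)"

end

theory Submission
  imports Defs
begin

text \<open>
  Write \<open>y = prox_{\<gamma> f}(u)\<close>, \<open>z = prox_{\<gamma> g}(2 y - u)\<close> and \<open>r = y - z\<close>.  The Douglas-Rachford step is a
  gradient step on a smooth function, the Douglas-Rachford envelope
  \<open>\<psi>(u) = f(y) - \<gamma>/2 |\<nabla>f(y)|^2 + g^\<gamma>(2 y - u)\<close>, where \<open>g^\<gamma>\<close> is the Moreau envelope of \<open>g\<close>: the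
  gradient is \<open>\<nabla>\<psi>(u) = M r\<close> with \<open>M = D^{-1}\<close>, so that \<open>r\<close> is the gradient with respect to the
  inner product \<open>a \<bullet> M b\<close>.  The accelerated method is therefore Nesterov's method for
  strongly convex functions, run on \<open>\<psi>\<close> in the metric \<open>M\<close>.

  Since \<open>f\<close> is quadratic, \<open>y\<close> is affine in \<open>u\<close>, and \<open>\<psi>\<close> is the sum of a quadratic and of \<open>g^\<gamma>\<close>
  composed with an affine map.  The substitution \<open>v - u = d + \<gamma> Q d\<close>, where \<open>d\<close> is the increment of
  \<open>y\<close>, turns every second-order estimate into a scalar inequality between \<open>d \<bullet> d\<close>, \<open>d \<bullet> Q d\<close> and
  \<open>Q d \<bullet> Q d\<close>.  The Rayleigh bounds and the inequality
  \<open>|Q d|^2 \<le> (\<mu> + L) d \<bullet> Q d - \<mu> L |d|^2\<close> (lemma \<open>norm_matrix_le_rayleigh\<close>), which says that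
  \<open>(Q - \<mu>)(L - Q)\<close> is positive semidefinite, then replace a diagonalization of \<open>Q\<close>.  The outcome is that \<open>\<psi>\<close> is
  \<open>\<mu>\<^sub>h\<close>-strongly convex and 1-smooth in the metric \<open>M\<close>
  (\<open>envelope_strongly_convex\<close>, \<open>envelope_smooth\<close>), and \<open>\<mu>\<^sub>h \<le> 1 \<le> L\<^sub>h\<close>.

  Nesterov's estimate usually bounds \<open>\<psi>(x\<^sup>k)\<close>, whereas the claim is about \<open>F(z\<^sup>k)\<close>, a
  quantity attached to the extrapolated point \<open>u\<^sup>k\<close>.  The proof of the estimate in fact
  bounds the larger quantity \<open>\<psi>(u\<^sup>k) - |r\<^sup>k|\<^sub>M^2 / (2 L\<^sub>h)\<close>, and this dominates \<open>F(z\<^sup>k)\<close> because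
  \<open>F(z) \<le> \<psi>(u) - (1 - \<gamma> L) / (2 \<gamma>) |r|^2\<close> (\<open>F_bwd_le\<close>, \<open>M_over_L_h_le\<close>).  At a fixed point
  \<open>x\<close> one has \<open>r = 0\<close> and \<open>\<psi>(x) = F\<^sub>\<star>\<close>, and smoothness bounds the initial gap by
  \<open>|x\<^sup>0 - x|\<^sub>M^2 / 2\<close>, with \<open>|a|\<^sub>M^2 \<le> |a|^2 / \<lambda>\<^sub>m\<^sub>i\<^sub>n(D)\<close>.
\<close>

section \<open>Rayleigh bounds for symmetric matrices\<close>

lemma inner_symmetric_matrix:
  fixes A :: "real^'n^'n"
  assumes "symmetric_matrix A"
  shows "(A *v x) \<bullet> y = x \<bullet> (A *v y)"
  using assms dot_lmul_matrix[of x A y] transpose_matrix_vector[of A x]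
  unfolding symmetric_matrix_def by simp

text \<open>Eigenvectors of distinct eigenvalues are orthogonal, so choosing one for every eigenvalue gives
  an independent set.\<close>

lemma finite_eigenvalues:
  fixes A :: "real^'n^'n"
  assumes "symmetric_matrix A"
  shows "finite (eigenvalues A)"
proof -
  have "\<forall>l\<in>eigenvalues A. \<exists>v. v \<noteq> 0 \<and> A *v v = l *\<^sub>R v"
    unfolding eigenvalues_def by simp
  from bchoice[OF this] obtain v
    where v: "\<And>l. l \<in> eigenvalues A \<Longrightarrow> v l \<noteq> 0 \<and> A *v v l = l *\<^sub>R v l"
    by blast
  have orth: "v l \<bullet> v m = 0" if "l \<in> eigenvalues A" "m \<in> eigenvalues A" "l \<noteq> m" for l m
  proof -
    have "l * (v l \<bullet> v m) = m * (v l \<bullet> v m)"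
      using inner_symmetric_matrix[OF assms, of "v l" "v m"] v[OF that(1)] v[OF that(2)] by simp
    with that(3) show ?thesis by simp
  qed
  have inj: "inj_on v (eigenvalues A)"
    by (intro inj_onI) (metis orth v inner_eq_zero_iff)
  have "pairwise orthogonal (v ` eigenvalues A)"
    using orth by (auto simp: pairwise_def orthogonal_def)
  moreover have "0 \<notin> v ` eigenvalues A" using v by force
  ultimately have "finite (v ` eigenvalues A)"
    using pairwise_orthogonal_independent independent_bound by blast
  with inj show ?thesis by (simp add: finite_image_iff)
qed

text \<open>The minimum \<open>l\<close> of the Rayleigh quotient over the unit sphere is attained at some \<open>v\<close>, and \<open>v\<close> is an
  eigenvector: moving from \<open>v\<close> along the residual \<open>r = A v - l v\<close> would otherwise
  decrease the quotient to first order.\<close>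

lemma ex_eigenvalue_below_rayleigh:
  fixes A :: "real^'n^'n"
  assumes A: "symmetric_matrix A"
  shows "\<exists>l\<in>eigenvalues A. \<forall>x. l * (x \<bullet> x) \<le> x \<bullet> (A *v x)"
proof -
  have "continuous_on (sphere 0 1) (\<lambda>x. x \<bullet> (A *v x))"
    by (intro continuous_intros linear_continuous_on matrix_vector_mul_bounded_linear)
  then obtain v where v: "norm v = 1"
    and vmin: "\<And>x. norm x = 1 \<Longrightarrow> v \<bullet> (A *v v) \<le> x \<bullet> (A *v x)"
    using continuous_attains_inf[of "sphere (0::real^'n) 1" "\<lambda>x. x \<bullet> (A *v x)"]
    by (auto simp: sphere_eq_empty)
  define l where "l = v \<bullet> (A *v v)"
  have low: "l * (x \<bullet> x) \<le> x \<bullet> (A *v x)" for x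
  proof (cases "x = 0")
    case False
    have "l \<le> (x /\<^sub>R norm x) \<bullet> (A *v (x /\<^sub>R norm x))"
      unfolding l_def using False by (intro vmin) simp
    also have "\<dots> = (x \<bullet> (A *v x)) / (x \<bullet> x)"
      by (simp add: matrix_vector_mult_scaleR dot_square_norm power2_eq_square field_simps)
    finally show ?thesis using False by (simp add: field_simps)
  qed simp
  define r where "r = A *v v - l *\<^sub>R v"
  define b where "b = r \<bullet> (A *v r) - l * (r \<bullet> r)"
  have vv: "v \<bullet> v = 1" using v by (simp add: dot_square_norm)
  have b: "0 \<le> b" using low[of r] by (simp add: b_def)
  have quad: "0 \<le> - 2 * s * (r \<bullet> r) + s\<^sup>2 * b" for s
  proof -
    have "r \<bullet> (A *v v) - l * (r \<bullet> v) = r \<bullet> r"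
      by (simp add: r_def inner_diff_right inner_diff_left inner_commute algebra_simps)
    moreover have "v \<bullet> (A *v r) = r \<bullet> (A *v v)"
      using inner_symmetric_matrix[OF A, of v r] by (simp add: inner_commute)
    ultimately show ?thesis
      using low[of "v - s *\<^sub>R r"] vv
      by (simp add: b_def l_def[symmetric] matrix_vector_mult_diff_distrib matrix_vector_mult_scaleR
          inner_diff_left inner_diff_right inner_commute[of v r] power2_eq_square)
         (simp add: algebra_simps)
  qed
  have "r \<bullet> r \<le> 0"
  proof -
    define s where "s = r \<bullet> r / (b + 1)"
    have rr: "r \<bullet> r = s * (b + 1)" using b by (simp add: s_def)
    have "- 2 * s * (r \<bullet> r) + s\<^sup>2 * b = - ((b + 2) * s\<^sup>2)"
      unfolding rr by (simp add: power2_eq_square algebra_simps)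
    then have "(b + 2) * s\<^sup>2 \<le> 0" using quad[of s] by linarith
    then have "s = 0" using b by (simp add: mult_le_0_iff)
    then show ?thesis using rr by simp
  qed
  then have "r \<bullet> r = 0" using inner_ge_zero[of r] by linarith
  then have "A *v v = l *\<^sub>R v" by (simp add: r_def)
  moreover have "v \<noteq> 0" using v by auto
  ultimately show ?thesis using low unfolding eigenvalues_def by blast
qed

lemma uminus_matrix_vector_mult: "(- A) *v v = - (A *v v)" for A :: "real^'n^'m"
  by (simp add: matrix_vector_mult_def vec_eq_iff sum_negf)

lemma eigenvalues_uminus: "eigenvalues (- A) = uminus ` eigenvalues (A :: real^'n^'n)"
proof -
  have iff: "l \<in> eigenvalues (- A) \<longleftrightarrow> - l \<in> eigenvalues A" for l
  proof -
    have "(- A) *v v = l *\<^sub>R v \<longleftrightarrow> A *v v = (- l) *\<^sub>R v" for v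
      by (metis add.inverse_inverse scaleR_minus_left uminus_matrix_vector_mult)
    then show ?thesis by (simp add: eigenvalues_def)
  qed
  show ?thesis
  proof safe
    fix l assume "l \<in> eigenvalues (- A)"
    then have "- l \<in> eigenvalues A" by (simp add: iff)
    then show "l \<in> uminus ` eigenvalues A" by (rule rev_image_eqI) simp
  qed (simp add: iff)
qed

lemma eigenvalues_nonempty: "symmetric_matrix A \<Longrightarrow> eigenvalues A \<noteq> {}"
  using ex_eigenvalue_below_rayleigh by blast

lemma lambda_min_le_rayleigh:
  fixes A :: "real^'n^'n"
  assumes "symmetric_matrix A"
  shows "lambda_min A * (x \<bullet> x) \<le> x \<bullet> (A *v x)"
proof -
  obtain l where "l \<in> eigenvalues A" and l: "l * (x \<bullet> x) \<le> x \<bullet> (A *v x)"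
    using ex_eigenvalue_below_rayleigh[OF assms] by blast
  then have "lambda_min A \<le> l"
    unfolding lambda_min_def by (simp add: Min_le finite_eigenvalues[OF assms])
  then have "lambda_min A * (x \<bullet> x) \<le> l * (x \<bullet> x)" by (intro mult_right_mono) auto
  with l show ?thesis by simp
qed

lemma lambda_max_ge_rayleigh:
  fixes A :: "real^'n^'n"
  assumes A: "symmetric_matrix A"
  shows "x \<bullet> (A *v x) \<le> lambda_max A * (x \<bullet> x)"
proof -
  have sym: "symmetric_matrix (- A)"
    using A by (simp add: symmetric_matrix_def transpose_def vec_eq_iff)
  have "lambda_min (- A) = - lambda_max A"
    unfolding lambda_min_def lambda_max_def eigenvalues_uminus
    using finite_eigenvalues[OF A] eigenvalues_nonempty[OF A]
    by (simp add: minus_Max_eq_Min)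
  then show ?thesis
    using lambda_min_le_rayleigh[OF sym, of x] by (simp add: uminus_matrix_vector_mult)
qed

lemma lambda_min_le_lambda_max:
  fixes A :: "real^'n^'n"
  assumes "symmetric_matrix A"
  shows "lambda_min A \<le> lambda_max A"
  unfolding lambda_min_def lambda_max_def
  using finite_eigenvalues[OF assms] eigenvalues_nonempty[OF assms] by simp

text \<open>For \<open>B = A - m\<close>, which satisfies \<open>0 \<le> B \<le> c\<close> with \<open>c = l - m\<close>, this is \<open>B^2 \<le> c B\<close>.  It follows from
  nonnegativity of the form \<open>B\<close> at \<open>x - B x / c\<close>.\<close>

lemma norm_matrix_le_rayleigh:
  fixes A :: "real^'n^'n"
  assumes A: "symmetric_matrix A"
    and low: "\<And>x. m * (x \<bullet> x) \<le> x \<bullet> (A *v x)" and up: "\<And>x. x \<bullet> (A *v x) \<le> l * (x \<bullet> x)"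
    and ml: "m \<le> l"
  shows "(A *v x) \<bullet> (A *v x) \<le> (m + l) * (x \<bullet> (A *v x)) - m * l * (x \<bullet> x)"
proof -
  define c where "c = l - m"
  define B where "B x = A *v x - m *\<^sub>R x" for x
  have nonneg: "0 \<le> y \<bullet> B y" for y using low[of y] by (simp add: B_def inner_diff_right)
  have le_c: "y \<bullet> B y \<le> c * (y \<bullet> y)" for y
    using up[of y] by (simp add: B_def c_def inner_diff_right algebra_simps)
  have sym: "B y \<bullet> w = y \<bullet> B w" for y w
    by (simp add: B_def inner_diff inner_symmetric_matrix[OF A])
  have step: "0 \<le> x \<bullet> B x - 2 * s * (B x \<bullet> B x) + s\<^sup>2 * (c * (B x \<bullet> B x))" for s
  proof -
    have "0 \<le> (x - s *\<^sub>R B x) \<bullet> B (x - s *\<^sub>R B x)" by (rule nonneg)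
    also have "B (x - s *\<^sub>R B x) = B x - s *\<^sub>R B (B x)"
      by (simp add: B_def matrix_vector_mult_diff_distrib matrix_vector_mult_scaleR algebra_simps)
    also have "(x - s *\<^sub>R B x) \<bullet> (B x - s *\<^sub>R B (B x))
        = x \<bullet> B x - 2 * s * (B x \<bullet> B x) + s\<^sup>2 * (B x \<bullet> B (B x))"
      using sym[of x "B x"] by (simp add: inner_diff power2_eq_square algebra_simps)
    finally show ?thesis using mult_left_mono[OF le_c[of "B x"], of "s\<^sup>2"] by simp
  qed
  have "B x \<bullet> B x \<le> c * (x \<bullet> B x)"
  proof (cases "c = 0")
    case True
    \<comment> \<open>Here \<open>x \<bullet> B x = 0\<close>, and any positive value of \<open>s\<close> does.\<close>
    then show ?thesis using step[of 1] le_c[of x] by simp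
  next
    case False
    then have "c > 0" using ml by (simp add: c_def)
    then show ?thesis using step[of "1 / c"]
      by (simp add: field_simps power2_eq_square)
  qed
  then show ?thesis
    by (simp add: B_def c_def inner_diff inner_symmetric_matrix[OF A] inner_commute algebra_simps power2_eq_square)
qed

lemma matrix_inv_inverse:
  assumes "invertible A"
  shows "A ** matrix_inv A = mat 1" "matrix_inv A ** A = mat 1"
  using someI_ex[OF assms[unfolded invertible_def]] unfolding matrix_inv_def by auto

section \<open>Proximal points and the Moreau envelope\<close>

text \<open>A hyperplane that separates the epigraph from a point strictly below its graph is not vertical
  when this point lies above the effective domain.\<close>

lemma affine_minorant:
  fixes g :: "'a::euclidean_space \<Rightarrow> ereal"
  assumes "proper_fun g" "closed_fun g" "convex_fun g"
  obtains a b where "\<And>x t. g x \<le> ereal t \<Longrightarrow> a \<bullet> x + b \<le> t"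
proof -
  obtain x0 where "g x0 \<noteq> \<infinity>" "g x0 \<noteq> -\<infinity>" using assms(1) unfolding proper_fun_def by blast
  then obtain g0 where g0: "g x0 = ereal g0" by (cases "g x0") auto
  let ?E = "ereal_epigraph g"
  have "(x0, g0 - 1) \<notin> ?E" by (simp add: ereal_epigraph_def g0)
  then obtain c b where below: "c \<bullet> (x0, g0 - 1) < b" and above: "\<And>e. e \<in> ?E \<Longrightarrow> b < c \<bullet> e"
    using separating_hyperplane_closed_point[of ?E "(x0, g0 - 1)"] assms(2,3)
    unfolding closed_fun_def convex_fun_def by blast
  obtain c1 c2 where c: "c = (c1, c2)" by (cases c)
  have "(x0, g0) \<in> ?E" by (simp add: ereal_epigraph_def g0)
  from above[OF this] below have "0 < c2" by (simp add: c algebra_simps)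
  show thesis
  proof (rule that[of "- c1 /\<^sub>R c2" "b / c2"])
    fix x t assume "g x \<le> ereal t"
    then have "b < c1 \<bullet> x + c2 * t" using above[of "(x, t)"] by (simp add: ereal_epigraph_def c)
    then show "(- c1 /\<^sub>R c2) \<bullet> x + b / c2 \<le> t" using \<open>0 < c2\<close> by (simp add: field_simps)
  qed
qed

text \<open>The affine minorant makes the objective coercive, so that its sublevel sets in the epigraph are
  compact.  Minimizing over the epigraph instead of the space replaces the lower semicontinuous
  objective by the continuous function \<open>\<Phi>\<close>.\<close>

lemma ex_prox_arg_min:
  fixes g :: "'a::euclidean_space \<Rightarrow> ereal"
  assumes "proper_fun g" "closed_fun g" "convex_fun g" and \<gamma>: "0 < \<gamma>"
  shows "\<exists>z. is_arg_min (\<lambda>z. g z + ereal (1 / (2 * \<gamma>) * (norm (z - p))\<^sup>2)) (\<lambda>_. True) z"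
proof -
  obtain a b where minor: "\<And>x t. g x \<le> ereal t \<Longrightarrow> a \<bullet> x + b \<le> t"
    using affine_minorant[OF assms(1-3)] by blast
  obtain x0 where "g x0 \<noteq> \<infinity>" "g x0 \<noteq> -\<infinity>" using assms(1) unfolding proper_fun_def by blast
  then obtain g0 where g0: "g x0 = ereal g0" by (cases "g x0") auto
  define \<Phi> :: "'a \<times> real \<Rightarrow> real" where "\<Phi> e = snd e + 1 / (2 * \<gamma>) * (norm (fst e - p))\<^sup>2" for e
  define E where "E = ereal_epigraph g"
  define K where "K = {e \<in> E. \<Phi> e \<le> \<Phi> (x0, g0)}"
  define C where "C = \<bar>\<Phi> (x0, g0) - b - a \<bullet> p\<bar>"
  define R where "R = 2 * \<gamma> * norm a + 2 * \<gamma> * C + 1"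
  \<comment> \<open>On \<open>K\<close> the distance \<open>n\<close> to \<open>p\<close> satisfies \<open>n^2 \<le> 2 \<gamma> |a| n + 2 \<gamma> C\<close>, which fails for \<open>n > R\<close>.\<close>
  have bound: "norm (x - p) \<le> R \<and> a \<bullet> p - norm a * R + b \<le> t \<and> t \<le> \<Phi> (x0, g0)"
    if "(x, t) \<in> K" for x t
  proof -
    define n where "n = norm (x - p)"
    have xt: "a \<bullet> x + b \<le> t" "t + 1 / (2 * \<gamma>) * n\<^sup>2 \<le> \<Phi> (x0, g0)"
      using that minor[of x t] by (auto simp: K_def E_def ereal_epigraph_def \<Phi>_def n_def)
    have "a \<bullet> x = a \<bullet> p + a \<bullet> (x - p)" by (simp add: inner_diff_right)
    moreover have "\<bar>a \<bullet> (x - p)\<bar> \<le> norm a * n" unfolding n_def by (rule Cauchy_Schwarz_ineq2)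
    ultimately have ax: "a \<bullet> p - norm a * n \<le> a \<bullet> x" by linarith
    have "1 / (2 * \<gamma>) * n\<^sup>2 \<le> norm a * n + C" using ax xt by (simp add: C_def)
    then have sq: "n * n \<le> 2 * \<gamma> * norm a * n + 2 * \<gamma> * C"
      using \<gamma> by (simp add: field_simps power2_eq_square)
    have "n \<le> R"
    proof (rule ccontr)
      assume "\<not> n \<le> R"
      moreover have nn: "0 \<le> 2 * \<gamma> * norm a" "0 \<le> 2 * \<gamma> * C" using \<gamma> by (simp_all add: C_def)
      ultimately have n: "1 \<le> n" "2 * \<gamma> * norm a + 2 * \<gamma> * C + 1 < n"
        unfolding R_def by linarith+
      have "(2 * \<gamma> * norm a + 2 * \<gamma> * C + 1) * n \<le> n * n"
        using n by (intro mult_right_mono) auto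
      moreover have "2 * \<gamma> * C * 1 \<le> 2 * \<gamma> * C * n" using n(1) nn by (intro mult_left_mono) auto
      ultimately show False using sq n by (simp add: algebra_simps)
    qed
    moreover have "norm a * n \<le> norm a * R" using \<open>n \<le> R\<close> by (intro mult_left_mono) auto
    moreover have "0 \<le> 1 / (2 * \<gamma>) * n\<^sup>2" using \<gamma> by simp
    ultimately show ?thesis using ax xt by (simp add: n_def)
  qed
  have "K \<subseteq> cball p R \<times> {a \<bullet> p - norm a * R + b..\<Phi> (x0, g0)}"
    using bound by (auto simp: dist_norm norm_minus_commute)
  moreover have "closed K"
  proof -
    have "continuous_on UNIV \<Phi>" unfolding \<Phi>_def by (intro continuous_intros)
    then have "closed {e. \<Phi> e \<le> \<Phi> (x0, g0)}" by (intro closed_Collect_le) auto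
    moreover have "K = E \<inter> {e. \<Phi> e \<le> \<Phi> (x0, g0)}" by (auto simp: K_def)
    ultimately show ?thesis using assms(2) by (auto simp: closed_fun_def E_def)
  qed
  ultimately have "compact K"
    using compact_Int_closed[OF compact_Times[OF compact_cball compact_Icc]] by (metis inf.absorb2)
  moreover have "(x0, g0) \<in> K" by (simp add: K_def E_def ereal_epigraph_def g0)
  moreover have "continuous_on K \<Phi>" unfolding \<Phi>_def by (intro continuous_intros)
  ultimately obtain e where e: "e \<in> K" "\<And>e'. e' \<in> K \<Longrightarrow> \<Phi> e \<le> \<Phi> e'"
    using continuous_attains_inf[of K \<Phi>] by blast
  obtain z t where zt: "e = (z, t)" by (cases e)
  have "g z + ereal (1 / (2 * \<gamma>) * (norm (z - p))\<^sup>2) \<le> g w + ereal (1 / (2 * \<gamma>) * (norm (w - p))\<^sup>2)" for w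
  proof (cases "g w")
    case (real s)
    have "\<Phi> e \<le> \<Phi> (w, s)"
    proof (cases "(w, s) \<in> K")
      case False
      then have "\<Phi> (x0, g0) < \<Phi> (w, s)" using real by (auto simp: K_def E_def ereal_epigraph_def)
      then show ?thesis using e(1) by (simp add: K_def)
    qed (rule e(2))
    then have "t + 1 / (2 * \<gamma>) * (norm (z - p))\<^sup>2 \<le> s + 1 / (2 * \<gamma>) * (norm (w - p))\<^sup>2"
      by (simp add: \<Phi>_def zt)
    moreover have "g z \<le> ereal t" using e(1) by (simp add: K_def E_def ereal_epigraph_def zt)
    then have "g z + ereal (1 / (2 * \<gamma>) * (norm (z - p))\<^sup>2)
        \<le> ereal t + ereal (1 / (2 * \<gamma>) * (norm (z - p))\<^sup>2)"
      by (rule add_right_mono)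
    ultimately show ?thesis using real by (simp add: order_trans)
  next
    case MInf
    then show ?thesis using assms(1) by (simp add: proper_fun_def)
  qed simp
  then show ?thesis by (auto simp: is_arg_min_linorder)
qed

text \<open>The second part is the subgradient inequality \<open>(p - z) / \<gamma> \<in> \<partial>g(z)\<close> at the proximal point.  It comes
  from comparing \<open>z\<close> with the points \<open>z + \<theta> (w - z)\<close> of the segment and letting \<open>\<theta>\<close> become small.\<close>

lemma prox_variational:
  fixes g :: "'a::euclidean_space \<Rightarrow> ereal" and p :: 'a
  assumes "proper_fun g" "closed_fun g" "convex_fun g" and \<gamma>: "0 < \<gamma>"
  defines "z \<equiv> prox \<gamma> g p"
  shows "g z = ereal (real_of_ereal (g z))" (is ?finite)
    and "g w \<le> ereal s \<Longrightarrow> real_of_ereal (g z) + (p - z) \<bullet> (w - z) / \<gamma> \<le> s"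
proof -
  have "is_arg_min (\<lambda>z. g z + ereal (1 / (2 * \<gamma>) * (norm (z - p))\<^sup>2)) (\<lambda>_. True) z"
    unfolding z_def prox_def arg_min_def by (rule someI_ex, rule ex_prox_arg_min[OF assms(1-4)])
  then have zmin: "g z + ereal (1 / (2 * \<gamma>) * (norm (z - p))\<^sup>2)
      \<le> g x + ereal (1 / (2 * \<gamma>) * (norm (x - p))\<^sup>2)" for x
    by (simp add: is_arg_min_linorder)
  obtain x0 where x0: "g x0 \<noteq> \<infinity>" using assms(1) unfolding proper_fun_def by blast
  have "g z \<noteq> \<infinity>" using zmin[of x0] x0 by auto
  moreover have "g z \<noteq> -\<infinity>" using assms(1) by (simp add: proper_fun_def)
  ultimately show fin: ?finite by (cases "g z") auto
  define t where "t = real_of_ereal (g z)"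
  have gz: "g z = ereal t" using fin by (simp add: t_def)
  assume ws: "g w \<le> ereal s"
  define X where "X = s - t + (z - p) \<bullet> (w - z) / \<gamma>"
  define Y where "Y = (norm (w - z))\<^sup>2 / (2 * \<gamma>)"
  have Y: "0 \<le> Y" using \<gamma> by (simp add: Y_def)
  have segment: "0 \<le> X + \<theta> * Y" if \<theta>: "0 < \<theta>" "\<theta> \<le> 1" for \<theta>
  proof -
    define v where "v = (1 - \<theta>) *\<^sub>R z + \<theta> *\<^sub>R w"
    have "(1 - \<theta>) *\<^sub>R (z, t) + \<theta> *\<^sub>R (w, s) \<in> ereal_epigraph g"
      using assms(3) ws gz \<theta> unfolding convex_fun_def
      by (intro convexD) (auto simp: ereal_epigraph_def)
    then have "g v \<le> ereal ((1 - \<theta>) * t + \<theta> * s)" by (simp add: ereal_epigraph_def v_def)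
    then have "g v + ereal (1 / (2 * \<gamma>) * (norm (v - p))\<^sup>2)
        \<le> ereal ((1 - \<theta>) * t + \<theta> * s) + ereal (1 / (2 * \<gamma>) * (norm (v - p))\<^sup>2)"
      by (rule add_right_mono)
    from order_trans[OF zmin[of v] this]
    have "t + 1 / (2 * \<gamma>) * (norm (z - p))\<^sup>2
        \<le> (1 - \<theta>) * t + \<theta> * s + 1 / (2 * \<gamma>) * (norm (v - p))\<^sup>2"
      by (simp add: gz)
    moreover have "v - p = (z - p) + \<theta> *\<^sub>R (w - z)" by (simp add: v_def algebra_simps)
    then have "(norm (v - p))\<^sup>2
        = (norm (z - p))\<^sup>2 + 2 * \<theta> * ((z - p) \<bullet> (w - z)) + \<theta>\<^sup>2 * (norm (w - z))\<^sup>2"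
      by (simp only: power2_norm_eq_inner inner_add inner_scaleR_left inner_scaleR_right)
         (simp add: inner_commute power2_eq_square distrib_left)
    ultimately have "0 \<le> \<theta> * (X + \<theta> * Y)"
      by (simp add: X_def Y_def distrib_left distrib_right left_diff_distrib right_diff_distrib power2_eq_square
            add_divide_distrib)
    then show ?thesis using \<theta> by (simp add: zero_le_mult_iff)
  qed
  have "0 \<le> X"
  proof (rule ccontr)
    assume "\<not> 0 \<le> X"
    then have X: "X < 0" by simp
    \<comment> \<open>This \<open>\<theta>\<close> gives \<open>(Y - X) (X + \<theta> Y) = - X^2 < 0\<close>.\<close>
    define \<theta> where "\<theta> = - X / (Y - X)"
    have YX: "0 < Y - X" using X Y by simp
    have "0 < \<theta>" unfolding \<theta>_def using X YX by (intro divide_pos_pos) auto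
    moreover have "\<theta> \<le> 1" unfolding \<theta>_def pos_divide_le_eq[OF YX] using Y by simp
    ultimately have "0 \<le> (Y - X) * (X + \<theta> * Y)" using segment[of \<theta>] YX by simp
    also have "\<dots> = (Y - X) * X + ((Y - X) * \<theta>) * Y" by (simp add: algebra_simps)
    also have "(Y - X) * \<theta> = - X" using YX by (simp add: \<theta>_def)
    finally have "0 \<le> - (X * X)" by (simp add: algebra_simps)
    then show False using mult_neg_neg[OF X X] by linarith
  qed
  moreover have "(z - p) \<bullet> (w - z) = - ((p - z) \<bullet> (w - z))" by (simp add: inner_diff_left)
  ultimately show "real_of_ereal (g z) + (p - z) \<bullet> (w - z) / \<gamma> \<le> s"
    by (simp add: X_def t_def)
qed

definition moreau_envelope :: "real \<Rightarrow> ('a::real_normed_vector \<Rightarrow> ereal) \<Rightarrow> 'a \<Rightarrow> real" where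
  "moreau_envelope \<gamma> g p
    = real_of_ereal (g (prox \<gamma> g p)) + 1 / (2 * \<gamma>) * (norm (prox \<gamma> g p - p))\<^sup>2"

text \<open>Both bounds combine the two subgradient inequalities between the proximal points of \<open>p\<close> and \<open>p'\<close>; the
  slack is a square.  Together they say that the Moreau envelope is convex and \<open>1/\<gamma>\<close>-smooth with
  gradient \<open>grad\<close>.\<close>

lemma moreau_envelope_bounds:
  fixes g :: "'a::euclidean_space \<Rightarrow> ereal"
  assumes g: "proper_fun g" "closed_fun g" "convex_fun g" and \<gamma>: "0 < \<gamma>"
  defines "grad \<equiv> \<lambda>p. (p - prox \<gamma> g p) /\<^sub>R \<gamma>"
  shows moreau_envelope_convex:
      "moreau_envelope \<gamma> g p + grad p \<bullet> (p' - p) \<le> moreau_envelope \<gamma> g p'"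
    and moreau_envelope_smooth:
      "moreau_envelope \<gamma> g p' \<le> moreau_envelope \<gamma> g p + grad p \<bullet> (p' - p) + 1 / (2 * \<gamma>) * (norm (p' - p))\<^sup>2"
proof -
  define z z' where "z = prox \<gamma> g p" and "z' = prox \<gamma> g p'"
  define t t' where "t = real_of_ereal (g z)" and "t' = real_of_ereal (g z')"
  define A C D where "A = p - z" and "C = (p' - z') - (p - z)" and "D = p' - p"
  have vecs: "z' - z = D - C" "z - z' = C - D" "p' - z' = A + C"
    by (simp_all add: A_def C_def D_def)
  have "t + A \<bullet> (z' - z) / \<gamma> \<le> t'" "t' + (p' - z') \<bullet> (z - z') / \<gamma> \<le> t"
    using prox_variational[OF g \<gamma>] unfolding t_def t'_def z_def z'_def A_def
    by (metis order_refl)+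
  then have le: "A \<bullet> D - A \<bullet> C \<le> \<gamma> * (t' - t)"
    "\<gamma> * (t' - t) \<le> A \<bullet> D - A \<bullet> C + C \<bullet> D - C \<bullet> C"
    unfolding vecs using \<gamma>
    by (simp_all add: field_simps inner_diff_right inner_add_left)
  have sq: "norm (z - p) = norm A" "norm (z' - p') = norm (A + C)"
    by (simp_all add: vecs(3)[symmetric] norm_minus_commute) (simp add: A_def norm_minus_commute)
  have AC: "(norm (A + C))\<^sup>2 = (norm A)\<^sup>2 + 2 * (A \<bullet> C) + C \<bullet> C"
    by (simp add: power2_norm_eq_inner inner_add inner_commute)
  have "0 \<le> (norm (D - C))\<^sup>2" by simp
  also have "\<dots> = (norm D)\<^sup>2 - 2 * (C \<bullet> D) + C \<bullet> C"
    by (simp add: power2_norm_eq_inner inner_diff inner_commute)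
  finally have DC: "0 \<le> (norm D)\<^sup>2 - 2 * (C \<bullet> D) + C \<bullet> C" .
  have lo: "A \<bullet> D \<le> \<gamma> * (t' - t) + (norm (A + C))\<^sup>2 / 2 - (norm A)\<^sup>2 / 2"
    using le(1) inner_ge_zero[of C] unfolding AC add_divide_distrib by linarith
  have hi: "\<gamma> * (t' - t) + (norm (A + C))\<^sup>2 / 2 - (norm A)\<^sup>2 / 2 \<le> A \<bullet> D + (norm D)\<^sup>2 / 2"
    using le(2) DC unfolding AC add_divide_distrib by linarith
  have half: "c / (2 * \<gamma>) * \<gamma> = c / 2" for c using \<gamma> by simp
  have lo': "A \<bullet> D / \<gamma> \<le> t' - t + (norm (A + C))\<^sup>2 / (2 * \<gamma>) - (norm A)\<^sup>2 / (2 * \<gamma>)"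
    unfolding pos_divide_le_eq[OF \<gamma>] distrib_right left_diff_distrib half
    using lo by (simp add: algebra_simps)
  have "t' - t + (norm (A + C))\<^sup>2 / (2 * \<gamma>) - (norm A)\<^sup>2 / (2 * \<gamma>) - (norm D)\<^sup>2 / (2 * \<gamma>) \<le> A \<bullet> D / \<gamma>"
    unfolding pos_le_divide_eq[OF \<gamma>] distrib_right left_diff_distrib half
    using hi by (simp add: algebra_simps)
  moreover have "grad p \<bullet> (p' - p) = A \<bullet> D / \<gamma>"
    by (simp add: grad_def A_def D_def z_def divide_inverse mult.commute)
  ultimately show "moreau_envelope \<gamma> g p + grad p \<bullet> (p' - p) \<le> moreau_envelope \<gamma> g p'"
    "moreau_envelope \<gamma> g p' \<le> moreau_envelope \<gamma> g p + grad p \<bullet> (p' - p) + 1 / (2 * \<gamma>) * (norm (p' - p))\<^sup>2"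
    using lo' unfolding moreau_envelope_def z_def[symmetric] z'_def[symmetric]
      t_def[symmetric] t'_def[symmetric] sq D_def[symmetric]
    by simp_all
qed

text \<open>The hypothesis on \<open>y\<close> is stationarity of the proximal objective.  That objective is
  quadratic, so around \<open>y\<close> it grows at least like \<open>|z - y|^2 / (2 \<gamma>)\<close>, which makes \<open>y\<close> its only minimizer.\<close>

lemma prox_quadratic:
  fixes Q :: "real^'n^'n"
  assumes Q: "symmetric_matrix Q" "pos_semidef Q" and \<gamma>: "0 < \<gamma>"
    and y: "y + \<gamma> *\<^sub>R (Q *v y + q) = u"
  shows "prox \<gamma> (\<lambda>v. ereal (quadratic Q q v)) u = y"
proof -
  define \<Phi> where "\<Phi> z = quadratic Q q z + 1 / (2 * \<gamma>) * (norm (z - u))\<^sup>2" for z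
  have \<Phi>_ge: "\<Phi> y + 1 / (2 * \<gamma>) * (norm (z - y))\<^sup>2 \<le> \<Phi> z" for z
  proof -
    define d where "d = z - y"
    define G where "G = Q *v y + q"
    have z: "z = y + d" by (simp add: d_def)
    have zu: "z - u = d - \<gamma> *\<^sub>R G" and yu: "y - u = - (\<gamma> *\<^sub>R G)"
      using y by (simp_all add: d_def G_def algebra_simps)
    have "quadratic Q q z = quadratic Q q y + G \<bullet> d + 1 / 2 * (d \<bullet> (Q *v d))"
      using inner_symmetric_matrix[OF Q(1), of y d] unfolding z
      by (simp add: quadratic_def G_def matrix_vector_right_distrib inner_add inner_commute field_simps)
    moreover have "0 \<le> d \<bullet> (Q *v d)" using Q(2) by (simp add: pos_semidef_def)
    moreover have "1 / (2 * \<gamma>) * (norm (z - u))\<^sup>2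
        = 1 / (2 * \<gamma>) * (norm d)\<^sup>2 - G \<bullet> d + 1 / (2 * \<gamma>) * (norm (y - u))\<^sup>2"
      unfolding zu yu power2_norm_eq_inner using \<gamma>
      by (simp add: inner_diff inner_commute power2_eq_square field_simps)
    ultimately show ?thesis by (simp add: \<Phi>_def d_def)
  qed
  have pos: "0 \<le> 1 / (2 * \<gamma>) * (norm (z - y))\<^sup>2" for z using \<gamma> by simp
  have min: "\<Phi> y \<le> \<Phi> z" for z using \<Phi>_ge[of z] pos[of z] by linarith
  have "is_arg_min (\<lambda>z. ereal (\<Phi> z)) (\<lambda>_. True) x \<longleftrightarrow> x = y" for x
  proof
    assume "is_arg_min (\<lambda>z. ereal (\<Phi> z)) (\<lambda>_. True) x"
    then have "\<Phi> x \<le> \<Phi> y" by (simp add: is_arg_min_linorder)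
    with \<Phi>_ge[of x] have "1 / (2 * \<gamma>) * (norm (x - y))\<^sup>2 \<le> 0" by linarith
    then show "x = y" using \<gamma> by (simp add: divide_le_0_iff)
  qed (simp add: is_arg_min_linorder min)
  then show ?thesis by (simp add: prox_def arg_min_def \<Phi>_def)
qed

section \<open>Accelerated gradient descent in a metric\<close>

text \<open>Nesterov's method with constant momentum in the (semi-)inner product \<open>a \<bullet> M b\<close>; \<open>r k\<close> plays the role
  of the gradient at \<open>u k\<close>.  The potential is \<open>\<Phi> k = \<psi>(x\<^sup>k) - \<psi>(xs) + \<mu>/2 |v\<^sup>k - xs|\<^sub>M^2\<close> with the auxiliary
  sequence \<open>v\<close> for which \<open>u\<^sup>k\<close> divides the segment from \<open>x\<^sup>k\<close> to \<open>v\<^sup>k\<close> in the ratio \<open>\<alpha> : 1\<close>.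

  The conclusion bounds the value \<open>\<psi>(u\<^sup>k) - |r\<^sup>k|\<^sub>M^2 / (2 L)\<close> that the descent step is guaranteed to reach
  instead of the value \<open>\<psi>(x\<^sup>k\<^sup>+\<^sup>1)\<close> that it does reach.  The contraction argument proves this stronger
  estimate at no cost: it shows \<open>\<Phi> (k+1) \<le> \<Psi> k \<le> (1 - \<alpha>) \<Phi> k\<close>, where \<open>\<Psi>\<close> contains the former
  value.\<close>

lemma nesterov_accelerated_descent:
  fixes x u r :: "nat \<Rightarrow> 'a::real_inner" and M :: "'a \<Rightarrow> 'a" and \<psi> :: "'a \<Rightarrow> real"
  assumes lin: "linear M" and sym: "\<And>a b. M a \<bullet> b = a \<bullet> M b" and pos: "\<And>a. 0 \<le> a \<bullet> M a"
    and \<mu>: "0 < \<mu>" "\<mu> \<le> L"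
    and u0: "u 0 = x 0"
    and x_step: "\<And>k. x (Suc k) = u k - (1 / L) *\<^sub>R r k"
    and u_step: "\<And>k. u (Suc k) = x (Suc k)
      + ((1 - sqrt (\<mu> / L)) / (1 + sqrt (\<mu> / L))) *\<^sub>R (x (Suc k) - x k)"
    and lower: "\<And>k v. \<psi> (u k) + r k \<bullet> M (v - u k) + \<mu> / 2 * ((v - u k) \<bullet> M (v - u k)) \<le> \<psi> v"
    and descent: "\<And>k. \<psi> (x (Suc k)) \<le> \<psi> (u k) - 1 / (2 * L) * (r k \<bullet> M (r k))"
  shows "\<psi> (u k) - 1 / (2 * L) * (r k \<bullet> M (r k)) - \<psi> xs
    \<le> (1 - sqrt (\<mu> / L)) ^ Suc k * (\<psi> (x 0) - \<psi> xs + \<mu> / 2 * ((x 0 - xs) \<bullet> M (x 0 - xs)))"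
proof -
  define \<alpha> where "\<alpha> = sqrt (\<mu> / L)"
  have L: "0 < L" using \<mu> by simp
  have \<alpha>: "0 < \<alpha>" "\<alpha> \<le> 1" and \<alpha>2: "\<alpha>\<^sup>2 = \<mu> / L"
    using \<mu> L by (simp_all add: \<alpha>_def)
  define v where "v k = x k + ((1 + \<alpha>) / \<alpha>) *\<^sub>R (u k - x k)" for k
  define \<Phi> where "\<Phi> k = \<psi> (x k) - \<psi> xs + \<mu> / 2 * ((v k - xs) \<bullet> M (v k - xs))" for k
  define \<Psi> where "\<Psi> k = \<psi> (u k) - 1 / (2 * L) * (r k \<bullet> M (r k)) - \<psi> xs
     + \<mu> / 2 * ((v (Suc k) - xs) \<bullet> M (v (Suc k) - xs))" for k
  have \<Phi>0: "\<Phi> 0 = \<psi> (x 0) - \<psi> xs + \<mu> / 2 * ((x 0 - xs) \<bullet> M (x 0 - xs))"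
    by (simp add: \<Phi>_def v_def u0)
  have \<Phi>_le: "\<Phi> (Suc k) \<le> \<Psi> k" for k
    using descent[of k] by (simp add: \<Phi>_def \<Psi>_def)
  have \<Psi>_le: "\<Psi> k \<le> (1 - \<alpha>) * \<Phi> k" for k
  proof -
    define V where "V = v k - u k"
    define X where "X = xs - u k"
    have x_u: "x k - u k = - (\<alpha> *\<^sub>R V)"
    proof -
      have "V = (1 / \<alpha>) *\<^sub>R (u k - x k)"
        using \<alpha> by (simp add: V_def v_def add_divide_distrib algebra_simps)
      then show ?thesis using \<alpha> by simp
    qed
    \<comment> \<open>Equivalently, the new \<open>v\<close> is \<open>(1 - \<alpha>) v + \<alpha> u - (\<alpha> / \<mu>) r\<close>.\<close>
    have v_next: "v (Suc k) - xs = (1 - \<alpha>) *\<^sub>R V - X - (\<alpha> / \<mu>) *\<^sub>R r k"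
    proof -
      have "v (Suc k) = x (Suc k) + ((1 - \<alpha>) / \<alpha>) *\<^sub>R (x (Suc k) - x k)"
        unfolding v_def u_step \<alpha>_def[symmetric] using \<alpha> by simp
      also have "x (Suc k) = u k - (\<alpha>\<^sup>2 / \<mu>) *\<^sub>R r k"
        using \<mu> L by (simp add: x_step \<alpha>2)
      also have "x k = u k - \<alpha> *\<^sub>R V" using x_u by (simp add: algebra_simps)
      finally have "v (Suc k) = u k - (\<alpha>\<^sup>2 / \<mu>) *\<^sub>R r k
         + ((1 - \<alpha>) / \<alpha>) *\<^sub>R (\<alpha> *\<^sub>R V - (\<alpha>\<^sup>2 / \<mu>) *\<^sub>R r k)"
        by (simp add: algebra_simps)
      also have "\<dots> = u k + (1 - \<alpha>) *\<^sub>R V - (\<alpha>\<^sup>2 / \<mu> + (1 - \<alpha>) / \<alpha> * (\<alpha>\<^sup>2 / \<mu>)) *\<^sub>R r k"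
        using \<alpha> by (simp add: scaleR_diff_right scaleR_add_left)
      also have "\<alpha>\<^sup>2 / \<mu> + (1 - \<alpha>) / \<alpha> * (\<alpha>\<^sup>2 / \<mu>) = \<alpha> / \<mu>"
        using \<alpha> \<mu> by (simp add: field_simps power2_eq_square)
      finally show ?thesis by (simp add: X_def algebra_simps)
    qed
    define rV rX rr VV VX XX where
      "rV = r k \<bullet> M V" and "rX = r k \<bullet> M X" and "rr = r k \<bullet> M (r k)"
      and "VV = V \<bullet> M V" and "VX = V \<bullet> M X" and "XX = X \<bullet> M X"
    have comm: "V \<bullet> M (r k) = rV" "X \<bullet> M (r k) = rX" "X \<bullet> M V = VX"
      unfolding rV_def rX_def VX_def by (metis sym inner_commute)+
    have at_xs: "\<psi> (u k) + rX + \<mu> / 2 * XX \<le> \<psi> xs"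
      using lower[of k xs] by (simp add: X_def rX_def XX_def)
    have at_x: "\<psi> (u k) - \<alpha> * rV \<le> \<psi> (x k)"
    proof -
      have "M (x k - u k) = - (\<alpha> *\<^sub>R M V)"
        unfolding x_u by (simp add: linear_neg[OF lin] linear_scale[OF lin])
      moreover have "0 \<le> (x k - u k) \<bullet> M (x k - u k)" by (rule pos)
      then have "0 \<le> \<mu> / 2 * ((x k - u k) \<bullet> M (x k - u k))" using \<mu> by simp
      ultimately show ?thesis
        using lower[of k "x k"] by (simp add: rV_def)
    qed
    have sq_next: "(v (Suc k) - xs) \<bullet> M (v (Suc k) - xs)
      = (1 - \<alpha>)\<^sup>2 * VV - 2 * (1 - \<alpha>) * VX + XX - 2 * (\<alpha> / \<mu>) * ((1 - \<alpha>) * rV - rX) + (\<alpha> / \<mu>)\<^sup>2 * rr"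
    proof -
      define W where "W = (1 - \<alpha>) *\<^sub>R V - X"
      have MW: "M W = (1 - \<alpha>) *\<^sub>R M V - M X"
        by (simp add: W_def linear_diff[OF lin] linear_scale[OF lin])
      have WW: "W \<bullet> M W = (1 - \<alpha>)\<^sup>2 * VV - 2 * (1 - \<alpha>) * VX + XX"
        unfolding MW unfolding W_def
        by (simp add: inner_diff comm VV_def VX_def XX_def power2_eq_square algebra_simps)
      have rW: "r k \<bullet> M W = (1 - \<alpha>) * rV - rX"
        unfolding MW by (simp add: inner_diff rV_def rX_def)
      have Wr: "W \<bullet> M (r k) = r k \<bullet> M W" by (metis sym inner_commute)
      have "(W - c *\<^sub>R r k) \<bullet> M (W - c *\<^sub>R r k)
          = W \<bullet> M W - 2 * c * (r k \<bullet> M W) + c\<^sup>2 * rr" for c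
        by (simp add: linear_diff[OF lin] linear_scale[OF lin] inner_diff Wr rr_def power2_eq_square)
           (simp add: algebra_simps)
      then show ?thesis unfolding v_next W_def[symmetric] WW rW .
    qed
    have sq_v: "(v k - xs) \<bullet> M (v k - xs) = VV - 2 * VX + XX"
    proof -
      have "v k - xs = V - X" by (simp add: V_def X_def)
      then show ?thesis by (simp add: linear_diff[OF lin] inner_diff comm VV_def VX_def XX_def)
    qed
    \<comment> \<open>This is where the step lengths match: the gain of the descent step pays for the
      square of \<open>r\<close>.\<close>
    have rr_cancel: "\<mu> / 2 * ((\<alpha> / \<mu>)\<^sup>2 * rr) = 1 / (2 * L) * rr"
    proof -
      have "\<mu> / 2 * ((\<alpha> / \<mu>)\<^sup>2 * rr) = \<alpha>\<^sup>2 / (2 * \<mu>) * rr"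
        using \<mu> by (simp add: field_simps power2_eq_square)
      then show ?thesis using \<mu> by (simp add: \<alpha>2)
    qed
    have cross: "\<mu> / 2 * (2 * (\<alpha> / \<mu>) * ((1 - \<alpha>) * rV - rX)) = \<alpha> * ((1 - \<alpha>) * rV - rX)"
      using \<mu> by simp
    have "\<Psi> k = \<psi> (u k) - \<psi> xs - \<alpha> * ((1 - \<alpha>) * rV - rX)
       + \<mu> / 2 * ((1 - \<alpha>)\<^sup>2 * VV - 2 * (1 - \<alpha>) * VX + XX)"
      unfolding \<Psi>_def sq_next rr_def[symmetric] using rr_cancel cross
      by (simp add: algebra_simps)
    \<comment> \<open>The lower bound at \<open>xs\<close> with weight \<open>\<alpha>\<close> plus the one at \<open>x k\<close> with weight \<open>1 - \<alpha>\<close>.\<close>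
    also have "\<dots> \<le> (1 - \<alpha>) * (\<psi> (x k) - \<psi> xs) + \<mu> / 2 * ((1 - \<alpha>)\<^sup>2 * VV - 2 * (1 - \<alpha>) * VX + (1 - \<alpha>) * XX)"
      using mult_left_mono[OF at_xs, of \<alpha>] mult_left_mono[OF at_x, of "1 - \<alpha>"] \<alpha>
      by (simp add: algebra_simps)
    also have "\<dots> \<le> (1 - \<alpha>) * (\<psi> (x k) - \<psi> xs) + \<mu> / 2 * ((1 - \<alpha>) * VV - 2 * (1 - \<alpha>) * VX + (1 - \<alpha>) * XX)"
    proof -
      have "(1 - \<alpha>)\<^sup>2 * VV \<le> (1 - \<alpha>) * VV"
        using \<alpha> pos[of V] by (intro mult_right_mono) (auto simp: VV_def power2_eq_square mult_left_le)
      then show ?thesis using \<mu> by simp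
    qed
    also have "\<dots> = (1 - \<alpha>) * \<Phi> k" unfolding \<Phi>_def sq_v by (simp add: field_simps)
    finally show ?thesis .
  qed
  have \<Phi>_pow: "\<Phi> k \<le> (1 - \<alpha>) ^ k * \<Phi> 0" for k
  proof (induction k)
    case (Suc k)
    have "\<Phi> (Suc k) \<le> (1 - \<alpha>) * \<Phi> k" using \<Phi>_le \<Psi>_le order_trans by blast
    also have "\<dots> \<le> (1 - \<alpha>) * ((1 - \<alpha>) ^ k * \<Phi> 0)"
      using Suc \<alpha> by (intro mult_left_mono) auto
    finally show ?case by (simp add: mult_ac)
  qed simp
  have "\<psi> (u k) - 1 / (2 * L) * (r k \<bullet> M (r k)) - \<psi> xs \<le> \<Psi> k"
    using pos[of "v (Suc k) - xs"] \<mu> by (simp add: \<Psi>_def)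
  also have "\<dots> \<le> (1 - \<alpha>) * \<Phi> k" by (rule \<Psi>_le)
  also have "\<dots> \<le> (1 - \<alpha>) * ((1 - \<alpha>) ^ k * \<Phi> 0)"
    using \<Phi>_pow \<alpha> by (intro mult_left_mono) auto
  finally show ?thesis by (simp add: \<Phi>0 \<alpha>_def mult_ac)
qed

section \<open>The Douglas-Rachford envelope for a quadratic function\<close>

locale quadratic_DR =
  fixes Q :: "real^'n^'n" and q :: "real^'n" and g :: "real^'n \<Rightarrow> ereal" and \<gamma> :: real
  assumes symQ: "symmetric_matrix Q" and mu_pos: "0 < lambda_min Q"
    and \<gamma>: "0 < \<gamma>" and step: "\<gamma> * lambda_max Q < 1"
    and g: "proper_fun g" "closed_fun g" "convex_fun g"
begin

abbreviation "\<mu> \<equiv> lambda_min Q"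
abbreviation "L \<equiv> lambda_max Q"

lemma mu_le_L: "\<mu> \<le> L" by (rule lambda_min_le_lambda_max[OF symQ])
lemma L_pos: "0 < L" using mu_pos mu_le_L by linarith

lemma Q_ge: "\<mu> * (x \<bullet> x) \<le> x \<bullet> (Q *v x)" by (rule lambda_min_le_rayleigh[OF symQ])
lemma Q_le: "x \<bullet> (Q *v x) \<le> L * (x \<bullet> x)" by (rule lambda_max_ge_rayleigh[OF symQ])
lemma QQ_le: "(Q *v x) \<bullet> (Q *v x) \<le> (\<mu> + L) * (x \<bullet> (Q *v x)) - \<mu> * L * (x \<bullet> x)"
  by (rule norm_matrix_le_rayleigh[OF symQ Q_ge Q_le mu_le_L])

lemma Q_nonneg: "0 \<le> x \<bullet> (Q *v x)"
  using Q_ge[of x] mu_pos by (meson inner_ge_zero mult_nonneg_nonneg less_imp_le order_trans)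

lemma QQ_le_L: "(Q *v x) \<bullet> (Q *v x) \<le> L * (x \<bullet> (Q *v x))"
proof -
  have "\<mu> * (x \<bullet> (Q *v x)) \<le> \<mu> * (L * (x \<bullet> x))" using Q_le mu_pos by (intro mult_left_mono) auto
  then show ?thesis using QQ_le[of x] by (simp add: algebra_simps)
qed

text \<open>From \<open>|(Q - \<mu>) x|^2 \<ge> 0\<close> together with the Rayleigh bound.\<close>

lemma QQ_ge_mu: "\<mu> * (x \<bullet> (Q *v x)) \<le> (Q *v x) \<bullet> (Q *v x)"
proof -
  have "0 \<le> (Q *v x - \<mu> *\<^sub>R x) \<bullet> (Q *v x - \<mu> *\<^sub>R x)" by simp
  then have "2 * (\<mu> * (x \<bullet> (Q *v x))) \<le> (Q *v x) \<bullet> (Q *v x) + \<mu> * (\<mu> * (x \<bullet> x))"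
    by (simp add: inner_diff inner_commute)
  moreover have "\<mu> * (\<mu> * (x \<bullet> x)) \<le> \<mu> * (x \<bullet> (Q *v x))"
    using Q_ge mu_pos by (intro mult_left_mono) auto
  ultimately show ?thesis by linarith
qed

lemma gQQ_le: "\<gamma> * ((Q *v x) \<bullet> (Q *v x)) \<le> x \<bullet> (Q *v x)"
proof -
  have "\<gamma> * ((Q *v x) \<bullet> (Q *v x)) \<le> \<gamma> * (L * (x \<bullet> (Q *v x)))"
    using QQ_le_L \<gamma> by (intro mult_left_mono) auto
  also have "\<dots> \<le> 1 * (x \<bullet> (Q *v x))"
    unfolding mult.assoc[symmetric] using step Q_nonneg by (intro mult_right_mono) auto
  finally show ?thesis by simp
qed

lemma gQ_le: "\<gamma> * (x \<bullet> (Q *v x)) \<le> \<gamma> * L * (x \<bullet> x)"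
  using mult_left_mono[OF Q_le, of \<gamma> x] \<gamma> by (simp add: mult.assoc)

text \<open>The resolvent identifies a vector \<open>w\<close> with \<open>d = P w\<close>, that is \<open>w = d + \<gamma> Q d\<close>.  In the coordinate \<open>d\<close>
  all the operators below are polynomials in \<open>Q\<close>.\<close>

definition P :: "real^'n^'n" where "P = matrix_inv (mat 1 + \<gamma> *\<^sub>R Q)"

lemma I_plus_mult: "(mat 1 + \<gamma> *\<^sub>R Q) *v x = x + \<gamma> *\<^sub>R (Q *v x)"
  by (simp add: matrix_vector_mult_add_rdistrib scaleR_matrix_vector_assoc)

lemma invertible_I_plus: "invertible (mat 1 + \<gamma> *\<^sub>R Q)"
  unfolding invertible_left_inverse matrix_left_invertible_ker
proof (intro allI impI)
  fix x assume "(mat 1 + \<gamma> *\<^sub>R Q) *v x = 0"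
  then have "x \<bullet> (x + \<gamma> *\<^sub>R (Q *v x)) = 0" by (simp add: I_plus_mult)
  then have "x \<bullet> x + \<gamma> * (x \<bullet> (Q *v x)) = 0" by (simp add: inner_add_right)
  moreover have "0 \<le> \<gamma> * (x \<bullet> (Q *v x))" using Q_nonneg[of x] \<gamma> by simp
  ultimately have "x \<bullet> x = 0" using inner_ge_zero[of x] by linarith
  then show "x = 0" by simp
qed

lemma P_left [simp]: "P *v (x + \<gamma> *\<^sub>R (Q *v x)) = x"
  using matrix_inv_inverse[OF invertible_I_plus]
  by (simp add: P_def I_plus_mult[symmetric] matrix_vector_mul_assoc)

lemma P_right [simp]: "P *v w + \<gamma> *\<^sub>R (Q *v (P *v w)) = w"
proof -
  have "(mat 1 + \<gamma> *\<^sub>R Q) *v (P *v w) = w"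
    using matrix_inv_inverse(1)[OF invertible_I_plus] by (simp add: P_def matrix_vector_mul_assoc)
  then show ?thesis by (simp only: I_plus_mult)
qed

text \<open>The inverse of \<open>D\<close>, which is the metric in which the method is a gradient method.\<close>

definition M :: "real^'n \<Rightarrow> real^'n" where "M w = (1 / \<gamma>) *\<^sub>R (2 *\<^sub>R (P *v w) - w)"

lemma M_eq: "M (d + \<gamma> *\<^sub>R (Q *v d)) = (1 / \<gamma>) *\<^sub>R (d - \<gamma> *\<^sub>R (Q *v d))"
  by (simp add: M_def scaleR_2)

lemma linear_M: "linear M"
  unfolding M_def by (intro linearI) (simp_all add: matrix_vector_right_distrib matrix_vector_mult_scaleR algebra_simps)

lemma M_inner_eq:
  "(d + \<gamma> *\<^sub>R (Q *v d)) \<bullet> M (d + \<gamma> *\<^sub>R (Q *v d)) = (1 / \<gamma>) * (d \<bullet> d - \<gamma>\<^sup>2 * ((Q *v d) \<bullet> (Q *v d)))"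
  unfolding M_eq by (simp add: inner_add inner_diff inner_commute power2_eq_square)

lemma M_sym: "M a \<bullet> b = a \<bullet> M b"
proof -
  define d e where "d = P *v a" and "e = P *v b"
  have ab: "a = d + \<gamma> *\<^sub>R (Q *v d)" "b = e + \<gamma> *\<^sub>R (Q *v e)" by (simp_all add: d_def e_def)
  show ?thesis unfolding ab M_eq
    using inner_symmetric_matrix[OF symQ, of d e]
    using \<gamma> by (simp add: inner_add inner_diff field_simps)
qed

lemma M_ge: "(1 / \<gamma>) * (d \<bullet> d - \<gamma> * (d \<bullet> (Q *v d)))
    \<le> (d + \<gamma> *\<^sub>R (Q *v d)) \<bullet> M (d + \<gamma> *\<^sub>R (Q *v d))"
  unfolding M_inner_eq using gQQ_le[of d] \<gamma>
  by (intro mult_left_mono) (simp_all add: power2_eq_square mult.assoc)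

lemma M_pos: "0 \<le> a \<bullet> M a"
proof -
  define d where "d = P *v a"
  have a: "a = d + \<gamma> *\<^sub>R (Q *v d)" by (simp add: d_def)
  have "\<gamma> * L * (d \<bullet> d) \<le> d \<bullet> d"
    using step mult_right_mono[of "\<gamma> * L" 1 "d \<bullet> d"] by simp
  then have "0 \<le> (1 / \<gamma>) * (d \<bullet> d - \<gamma> * (d \<bullet> (Q *v d)))"
    using order_trans[OF gQ_le[of d]] \<gamma> by (intro mult_nonneg_nonneg) auto
  then show ?thesis using M_ge[of d] unfolding a by linarith
qed

text \<open>The smallest eigenvalue of \<open>D\<close>, as shown in \<open>lambda_min_D_matrix\<close> below.\<close>

definition "\<delta> = \<gamma> * (1 + \<gamma> * \<mu>) / (1 - \<gamma> * \<mu>)"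

lemma step_mu: "\<gamma> * \<mu> < 1" using step mult_left_mono[OF mu_le_L, of \<gamma>] \<gamma> by linarith

lemma delta_pos: "0 < \<delta>"
  unfolding \<delta>_def using \<gamma> mu_pos step_mu by (intro divide_pos_pos mult_pos_pos) (auto intro: add_pos_pos)

text \<open>In the coordinate \<open>d\<close>, the difference of the two sides is a positive multiple of
  \<open>d \<bullet> (1 + \<gamma> Q)(Q - \<mu>) d\<close>.\<close>

lemma M_le: "\<delta> * (a \<bullet> M a) \<le> a \<bullet> a"
proof -
  define d where "d = P *v a"
  have a: "a = d + \<gamma> *\<^sub>R (Q *v d)" by (simp add: d_def)
  define N A C where "N = d \<bullet> d" and "A = d \<bullet> (Q *v d)" and "C = (Q *v d) \<bullet> (Q *v d)"
  have "a \<bullet> a = N + 2 * \<gamma> * A + \<gamma>\<^sup>2 * C"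
    unfolding a N_def A_def C_def by (simp add: inner_add inner_commute power2_eq_square)
  moreover have "\<delta> * (a \<bullet> M a) = (1 + \<gamma> * \<mu>) * (N - \<gamma>\<^sup>2 * C) / (1 - \<gamma> * \<mu>)"
    unfolding a M_inner_eq using \<gamma> by (simp add: \<delta>_def N_def C_def)
  moreover have "(1 + \<gamma> * \<mu>) * (N - \<gamma>\<^sup>2 * C) \<le> (N + 2 * \<gamma> * A + \<gamma>\<^sup>2 * C) * (1 - \<gamma> * \<mu>)"
  proof -
    have "0 \<le> 2 * \<gamma> * ((A - \<mu> * N) + \<gamma> * (C - \<mu> * A))"
      using Q_ge[of d] QQ_ge_mu[of d] \<gamma> unfolding N_def A_def C_def
      by (intro mult_nonneg_nonneg add_nonneg_nonneg) auto
    also have "\<dots> = (N + 2 * \<gamma> * A + \<gamma>\<^sup>2 * C) * (1 - \<gamma> * \<mu>) - (1 + \<gamma> * \<mu>) * (N - \<gamma>\<^sup>2 * C)"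
      by (simp add: algebra_simps power2_eq_square)
    finally show ?thesis by simp
  qed
  ultimately show ?thesis using step_mu by (simp add: pos_divide_le_eq)
qed

text \<open>A bound from below for the eigenvalues \<open>(1 - \<gamma> t) t / (1 + \<gamma> t)^2\<close>, \<open>\<mu> \<le> t \<le> L\<close>, of the Hessian of the quadratic part of
  the envelope.\<close>

definition "min_curv = min ((1 - \<gamma> * \<mu>) * \<mu> / (1 + \<gamma> * \<mu>)\<^sup>2) ((1 - \<gamma> * L) * L / (1 + \<gamma> * L)\<^sup>2)"

lemma min_curv_pos: "0 < min_curv"
  unfolding min_curv_def using \<gamma> mu_pos L_pos step step_mu
  by (auto intro!: divide_pos_pos mult_pos_pos zero_less_power add_pos_pos)

text \<open>The claim is that \<open>p(Q)\<close> is positive semidefinite for the polynomial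
  \<open>p(t) = t - \<gamma> t^2 - min_curv (1 + \<gamma> t)^2\<close>.  This \<open>p\<close> is concave and nonnegative at
  \<open>\<mu>\<close> and at \<open>L\<close>, so it is the nonnegative affine interpolation between these points plus a
  nonnegative multiple \<open>c\<close> of \<open>(t - \<mu>)(L - t)\<close>, and \<open>(Q - \<mu>)(L - Q)\<close> is positive semidefinite.\<close>

lemma curvature:
  "min_curv * ((d + \<gamma> *\<^sub>R (Q *v d)) \<bullet> (d + \<gamma> *\<^sub>R (Q *v d))) \<le> d \<bullet> (Q *v d) - \<gamma> * ((Q *v d) \<bullet> (Q *v d))"
proof -
  define N A C where "N = d \<bullet> d" and "A = d \<bullet> (Q *v d)" and "C = (Q *v d) \<bullet> (Q *v d)"
  define p where "p t = t - \<gamma> * t\<^sup>2 - min_curv * (1 + \<gamma> * t)\<^sup>2" for t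
  have "0 \<le> p \<mu>" "0 \<le> p L"
  proof -
    have "min_curv \<le> (1 - \<gamma> * \<mu>) * \<mu> / (1 + \<gamma> * \<mu>)\<^sup>2" "min_curv \<le> (1 - \<gamma> * L) * L / (1 + \<gamma> * L)\<^sup>2"
      by (simp_all add: min_curv_def)
    moreover have "0 < 1 + \<gamma> * \<mu>" "0 < 1 + \<gamma> * L"
      using \<gamma> mu_pos L_pos by (simp_all add: add_pos_pos)
    then have "0 < (1 + \<gamma> * \<mu>)\<^sup>2" "0 < (1 + \<gamma> * L)\<^sup>2" by simp_all
    ultimately show "0 \<le> p \<mu>" "0 \<le> p L"
      by (simp_all add: p_def pos_le_divide_eq) (simp_all add: algebra_simps power2_eq_square)
  qed
  have N: "0 \<le> N" by (simp add: N_def)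
  have A: "\<mu> * N \<le> A" "A \<le> L * N" using Q_ge Q_le by (simp_all add: N_def A_def)
  have C: "C \<le> (\<mu> + L) * A - \<mu> * L * N" using QQ_le by (simp add: N_def A_def C_def)
  have "0 \<le> A - \<gamma> * C - min_curv * (N + 2 * \<gamma> * A + \<gamma>\<^sup>2 * C)" (is "0 \<le> ?lhs")
  proof -
    define c where "c = \<gamma> + min_curv * \<gamma>\<^sup>2"
    have c: "0 \<le> c" using \<gamma> min_curv_pos by (simp add: c_def)
    have lhs: "?lhs = (1 - 2 * min_curv * \<gamma>) * A - min_curv * N - c * C"
      by (simp add: c_def algebra_simps)
    have p: "p t = (1 - 2 * min_curv * \<gamma>) * t - min_curv - c * t\<^sup>2" for t
      by (simp add: p_def c_def algebra_simps power2_eq_square)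
    have "c * C \<le> c * ((\<mu> + L) * A - \<mu> * L * N)" using C c by (intro mult_left_mono)
    then have ge: "(1 - 2 * min_curv * \<gamma>) * A - min_curv * N - c * ((\<mu> + L) * A - \<mu> * L * N) \<le> ?lhs"
      unfolding lhs by simp
    \<comment> \<open>The contribution of the affine interpolation of \<open>p\<close> between \<open>\<mu>\<close> and \<open>L\<close>.\<close>
    define E where "E = (1 - 2 * min_curv * \<gamma>) * A - min_curv * N - c * ((\<mu> + L) * A - \<mu> * L * N)"
    show ?thesis
    proof (cases "\<mu> = L")
      case True
      then have "A = \<mu> * N" using A by simp
      then have "E = p \<mu> * N" unfolding E_def p by (simp add: True algebra_simps power2_eq_square)
      then have "0 \<le> E" using N \<open>0 \<le> p \<mu>\<close> by simp
      then show ?thesis using ge unfolding E_def by linarith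
    next
      case False
      then have mL: "0 < L - \<mu>" using mu_le_L by simp
      have "(L - \<mu>) * E = p \<mu> * (L * N - A) + p L * (A - \<mu> * N)"
        unfolding E_def p by (simp add: algebra_simps power2_eq_square)
      also have "0 \<le> \<dots>" using A \<open>0 \<le> p \<mu>\<close> \<open>0 \<le> p L\<close> by simp
      finally have "0 \<le> E" using mL by (simp add: zero_le_mult_iff)
      then show ?thesis using ge unfolding E_def by linarith
    qed
  qed
  moreover have "(d + \<gamma> *\<^sub>R (Q *v d)) \<bullet> (d + \<gamma> *\<^sub>R (Q *v d)) = N + 2 * \<gamma> * A + \<gamma>\<^sup>2 * C"
    unfolding N_def A_def C_def by (simp add: inner_add inner_commute power2_eq_square)
  ultimately show ?thesis by (simp add: A_def C_def)
qed

text \<open>A closed form of \<open>prox_{\<gamma> f}\<close>, see \<open>prox_f\<close> below.  It is affine, which is what makes the envelope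
  tractable.\<close>

definition fwd :: "real^'n \<Rightarrow> real^'n" where "fwd u = P *v (u - \<gamma> *\<^sub>R q)"

definition grad :: "real^'n \<Rightarrow> real^'n" where "grad u = Q *v fwd u + q"

definition bwd :: "real^'n \<Rightarrow> real^'n" where "bwd u = prox \<gamma> g (2 *\<^sub>R fwd u - u)"

definition envelope :: "real^'n \<Rightarrow> real" where
  "envelope u = quadratic Q q (fwd u) - \<gamma> / 2 * (norm (grad u))\<^sup>2
     + moreau_envelope \<gamma> g (2 *\<^sub>R fwd u - u)"

lemma fwd_grad: "u = fwd u + \<gamma> *\<^sub>R grad u"
proof -
  have "fwd u + \<gamma> *\<^sub>R (Q *v fwd u) = u - \<gamma> *\<^sub>R q" unfolding fwd_def by (rule P_right)
  then show ?thesis by (simp add: grad_def scaleR_add_right algebra_simps)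
qed

lemma prox_f: "prox \<gamma> (\<lambda>v. ereal (quadratic Q q v)) u = fwd u"
  using fwd_grad[of u] Q_nonneg
  by (intro prox_quadratic symQ \<gamma>) (simp_all add: pos_semidef_def grad_def)

lemma quadratic_expand:
  "quadratic Q q (fwd u + d) = quadratic Q q (fwd u) + grad u \<bullet> d + 1 / 2 * (d \<bullet> (Q *v d))"
  using inner_symmetric_matrix[OF symQ, of "fwd u" d]
  by (simp add: quadratic_def grad_def matrix_vector_right_distrib inner_add inner_commute field_simps)

text \<open>The exact remainder of the envelope after its linear part: a quadratic form coming from \<open>f\<close>, and
  the remainder of the Moreau envelope along \<open>p' - p\<close>.  The gradients of the two parts of the
  envelope add up to \<open>M (fwd u - bwd u)\<close> because the \<open>grad u\<close> terms cancel.\<close>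

lemma envelope_expansion:
  fixes u v
  defines "d \<equiv> fwd v - fwd u" and "p \<equiv> 2 *\<^sub>R fwd u - u" and "p' \<equiv> 2 *\<^sub>R fwd v - v"
  shows "v - u = d + \<gamma> *\<^sub>R (Q *v d)" (is ?vu)
    and "p' - p = d - \<gamma> *\<^sub>R (Q *v d)" (is ?pp)
    and "envelope v - envelope u = (fwd u - bwd u) \<bullet> M (v - u)
      + 1 / 2 * (d \<bullet> (Q *v d) - \<gamma> * ((Q *v d) \<bullet> (Q *v d)))
      + (moreau_envelope \<gamma> g p' - moreau_envelope \<gamma> g p - ((p - bwd u) /\<^sub>R \<gamma>) \<bullet> (p' - p))"
proof -
  have fv: "fwd v = fwd u + d" by (simp add: d_def)
  have gv: "grad v = grad u + Q *v d"
    by (simp add: grad_def fv matrix_vector_right_distrib)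
  show vu: ?vu using fwd_grad[of u] fwd_grad[of v] unfolding fv gv by (simp add: algebra_simps)
  show pp: ?pp using vu unfolding p_def p'_def fv by (simp add: algebra_simps scaleR_2)
  have quad: "quadratic Q q (fwd v) - \<gamma> / 2 * (norm (grad v))\<^sup>2
      = quadratic Q q (fwd u) - \<gamma> / 2 * (norm (grad u))\<^sup>2 + grad u \<bullet> (d - \<gamma> *\<^sub>R (Q *v d))
        + 1 / 2 * (d \<bullet> (Q *v d) - \<gamma> * ((Q *v d) \<bullet> (Q *v d)))"
    unfolding fv gv quadratic_expand
    by (simp add: power2_norm_eq_inner inner_add inner_diff inner_commute field_simps)
  define r where "r = fwd u - bwd u"
  have "p - bwd u = r - \<gamma> *\<^sub>R grad u"
    using fwd_grad[of u] by (simp add: p_def r_def scaleR_2 algebra_simps)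
  then have "((p - bwd u) /\<^sub>R \<gamma>) \<bullet> w = r \<bullet> ((1 / \<gamma>) *\<^sub>R w) - grad u \<bullet> w" for w
    using \<gamma> by (simp add: inner_diff_left right_diff_distrib divide_inverse mult.commute)
  then have lin: "((p - bwd u) /\<^sub>R \<gamma>) \<bullet> (p' - p) = (fwd u - bwd u) \<bullet> M (v - u) - grad u \<bullet> (p' - p)"
    unfolding vu M_eq pp r_def by simp
  show "envelope v - envelope u = (fwd u - bwd u) \<bullet> M (v - u)
      + 1 / 2 * (d \<bullet> (Q *v d) - \<gamma> * ((Q *v d) \<bullet> (Q *v d)))
      + (moreau_envelope \<gamma> g p' - moreau_envelope \<gamma> g p - ((p - bwd u) /\<^sub>R \<gamma>) \<bullet> (p' - p))"
    using lin quad unfolding envelope_def p_def[symmetric] p'_def[symmetric] pp by linarith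
qed

text \<open>The Moreau envelope is convex, so the quadratic remainder of \<open>envelope_expansion\<close> is all that is
  needed; \<open>curvature\<close> bounds it from below by a multiple of \<open>|v - u|^2\<close>, and \<open>M_le\<close> passes from there to the metric \<open>M\<close>.\<close>

lemma envelope_strongly_convex:
  "envelope u + (fwd u - bwd u) \<bullet> M (v - u) + \<delta> * min_curv / 2 * ((v - u) \<bullet> M (v - u)) \<le> envelope v"
proof -
  define d where "d = fwd v - fwd u"
  have "(\<delta> * min_curv) * ((v - u) \<bullet> M (v - u)) \<le> min_curv * ((v - u) \<bullet> (v - u))"
    using mult_left_mono[OF M_le, of min_curv "v - u"] min_curv_pos by (simp add: mult_ac)
  also have "\<dots> \<le> d \<bullet> (Q *v d) - \<gamma> * ((Q *v d) \<bullet> (Q *v d))"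
    unfolding d_def envelope_expansion(1)[of v u] by (rule curvature)
  finally have "\<delta> * min_curv / 2 * ((v - u) \<bullet> M (v - u))
      \<le> 1 / 2 * (d \<bullet> (Q *v d) - \<gamma> * ((Q *v d) \<bullet> (Q *v d)))" by simp
  then show ?thesis
    using envelope_expansion(3)[of v u] moreau_envelope_convex[OF g \<gamma>, of "2 *\<^sub>R fwd u - u" "2 *\<^sub>R fwd v - v"]
    unfolding bwd_def[symmetric] d_def[symmetric] by linarith
qed

text \<open>In the coordinate \<open>d\<close> the quadratic part and the square \<open>|p' - p|^2 / (2 \<gamma>)\<close> together give
  \<open>d \<bullet> (1 - \<gamma> Q) d / (2 \<gamma>)\<close>, which is at most half the squared \<open>M\<close>-norm of \<open>v - u\<close>.\<close>

lemma envelope_smooth: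
  "envelope v \<le> envelope u + (fwd u - bwd u) \<bullet> M (v - u) + 1 / 2 * ((v - u) \<bullet> M (v - u))"
proof -
  define d where "d = fwd v - fwd u"
  define N A C where "N = d \<bullet> d" and "A = d \<bullet> (Q *v d)" and "C = (Q *v d) \<bullet> (Q *v d)"
  have "(norm ((2 *\<^sub>R fwd v - v) - (2 *\<^sub>R fwd u - u)))\<^sup>2 = N - 2 * \<gamma> * A + \<gamma>\<^sup>2 * C"
    unfolding envelope_expansion(2)[of v u] d_def[symmetric] N_def A_def C_def power2_norm_eq_inner
    by (simp add: inner_diff inner_commute power2_eq_square)
  then have "1 / (2 * \<gamma>) * (norm ((2 *\<^sub>R fwd v - v) - (2 *\<^sub>R fwd u - u)))\<^sup>2
      = 1 / (2 * \<gamma>) * (N - 2 * \<gamma> * A + \<gamma>\<^sup>2 * C)" by simp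
  moreover have "1 / 2 * (A - \<gamma> * C) + 1 / (2 * \<gamma>) * (N - 2 * \<gamma> * A + \<gamma>\<^sup>2 * C) = 1 / 2 * ((1 / \<gamma>) * (N - \<gamma> * A))"
    using \<gamma> by (simp add: field_simps power2_eq_square)
  moreover have "(1 / \<gamma>) * (N - \<gamma> * A) \<le> (v - u) \<bullet> M (v - u)"
    unfolding envelope_expansion(1)[of v u] d_def[symmetric] N_def A_def by (rule M_ge)
  ultimately show ?thesis
    using envelope_expansion(3)[of v u] moreau_envelope_smooth[OF g \<gamma>, of "2 *\<^sub>R fwd v - v" "2 *\<^sub>R fwd u - u"]
    unfolding bwd_def[symmetric] d_def[symmetric] A_def[symmetric] C_def[symmetric] by linarith
qed

text \<open>The forward-backward form of the envelope: \<open>f\<close> linearized at \<open>fwd u\<close>, plus \<open>g\<close> and the proximal term.\<close>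

lemma envelope_eq:
  "envelope u = quadratic Q q (fwd u) + grad u \<bullet> (bwd u - fwd u) + real_of_ereal (g (bwd u))
     + 1 / (2 * \<gamma>) * (norm (bwd u - fwd u))\<^sup>2"
proof -
  define e where "e = bwd u - fwd u"
  have shift: "bwd u - (2 *\<^sub>R fwd u - u) = e + \<gamma> *\<^sub>R grad u"
    using fwd_grad[of u] by (simp add: e_def scaleR_2 algebra_simps)
  have "1 / (2 * \<gamma>) * (norm (bwd u - (2 *\<^sub>R fwd u - u)))\<^sup>2
      = 1 / (2 * \<gamma>) * (norm e)\<^sup>2 + grad u \<bullet> e + \<gamma> / 2 * (norm (grad u))\<^sup>2"
    unfolding shift power2_norm_eq_inner
    using \<gamma> by (simp add: inner_add inner_commute field_simps)
  then show ?thesis unfolding envelope_def moreau_envelope_def bwd_def[symmetric] e_def by simp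
qed

text \<open>In the form \<open>envelope_eq\<close>, the linearization of \<open>f\<close> and \<open>f\<close> itself differ at \<open>bwd u\<close> by at most
  \<open>L/2 |fwd u - bwd u|^2\<close>.\<close>

lemma F_bwd_le: "quadratic Q q (bwd u) + real_of_ereal (g (bwd u))
    \<le> envelope u - (1 - \<gamma> * L) / (2 * \<gamma>) * (norm (fwd u - bwd u))\<^sup>2"
proof -
  define d where "d = bwd u - fwd u"
  have "bwd u = fwd u + d" by (simp add: d_def)
  then have "quadratic Q q (bwd u) \<le> quadratic Q q (fwd u) + grad u \<bullet> d + L / 2 * (norm d)\<^sup>2"
    using quadratic_expand[of u d] Q_le[of d] by (simp add: power2_norm_eq_inner)
  moreover have "L / 2 * (norm d)\<^sup>2 = 1 / (2 * \<gamma>) * (norm d)\<^sup>2 - (1 - \<gamma> * L) / (2 * \<gamma>) * (norm d)\<^sup>2"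
    using \<gamma> by (simp add: field_simps)
  moreover have dist: "norm (fwd u - bwd u) = norm d" by (simp add: d_def norm_minus_commute)
  ultimately show ?thesis unfolding envelope_eq d_def[symmetric] dist by linarith
qed

text \<open>At a fixed point the subgradient of \<open>g\<close> at \<open>bwd u\<close> is \<open>- grad u\<close>, so \<open>fwd u\<close> minimizes \<open>F\<close>, and
  the value of the envelope is the minimum.\<close>

lemma envelope_fixed_point_le:
  assumes "bwd u = fwd u"
  shows "ereal (envelope u) \<le> ereal (quadratic Q q w) + g w"
proof (cases "g w")
  case (real s)
  have "2 *\<^sub>R fwd u - u - bwd u = - (\<gamma> *\<^sub>R grad u)"
    using fwd_grad[of u] assms by (simp add: scaleR_2 algebra_simps)
  then have "(2 *\<^sub>R fwd u - u - bwd u) \<bullet> (w - bwd u) / \<gamma> = - (grad u \<bullet> (w - fwd u))"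
    using \<gamma> by (simp add: assms)
  then have "real_of_ereal (g (bwd u)) - grad u \<bullet> (w - fwd u) \<le> s"
    using prox_variational(2)[OF g \<gamma>, of w s "2 *\<^sub>R fwd u - u"] real
    unfolding bwd_def[symmetric] by simp
  moreover have "quadratic Q q (fwd u) + grad u \<bullet> (w - fwd u) \<le> quadratic Q q w"
    using quadratic_expand[of u "w - fwd u"] Q_nonneg[of "w - fwd u"] by simp
  ultimately show ?thesis unfolding envelope_eq real by (simp add: assms)
next
  case MInf
  then show ?thesis using g(1) by (simp add: proper_fun_def)
qed simp

section \<open>The constants and the rate\<close>

text \<open>The eigenvalues of \<open>D\<close> are the numbers \<open>\<phi> t = \<gamma> (1 + \<gamma> t) / (1 - \<gamma> t)\<close> for the eigenvalues \<open>t\<close> of \<open>Q\<close>, and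
  \<open>\<phi>\<close> is increasing.  Both inclusions use that \<open>D\<close> maps \<open>d - \<gamma> Q d\<close> to \<open>\<gamma> (d + \<gamma> Q d)\<close>.\<close>

lemma lambda_min_D_matrix: "lambda_min (D_matrix Q \<gamma>) = \<delta>"
proof -
  define B where "B = 2 *\<^sub>R P - mat 1"
  define \<phi> where "\<phi> t = \<gamma> * (1 + \<gamma> * t) / (1 - \<gamma> * t)" for t
  have B_mult: "B *v (d + \<gamma> *\<^sub>R (Q *v d)) = d - \<gamma> *\<^sub>R (Q *v d)" for d
    by (simp only: B_def matrix_vector_mult_diff_rdistrib scaleR_matrix_vector_assoc[symmetric] P_left)
       (simp add: scaleR_2)
  have ker: "d = 0" if "d - \<gamma> *\<^sub>R (Q *v d) = 0" for d
  proof -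
    have "d \<bullet> (d - \<gamma> *\<^sub>R (Q *v d)) = 0" using that by simp
    then have "(1 - \<gamma> * L) * (d \<bullet> d) \<le> 0"
      using gQ_le[of d] by (simp only: inner_diff_right inner_scaleR_right left_diff_distrib)
    then have "d \<bullet> d \<le> 0" using step by (simp add: mult_le_0_iff)
    then have "d \<bullet> d = 0" using inner_ge_zero[of d] by linarith
    then show ?thesis by simp
  qed
  have inv: "invertible B"
    unfolding invertible_left_inverse matrix_left_invertible_ker
  proof (intro allI impI)
    fix w assume "B *v w = 0"
    then have "P *v w - \<gamma> *\<^sub>R (Q *v (P *v w)) = 0" using B_mult[of "P *v w"] unfolding P_right by metis
    then have "P *v w = 0" by (rule ker)
    then show "w = 0" using P_right[of w] by simp
  qed
  have D: "D_matrix Q \<gamma> = \<gamma> *\<^sub>R matrix_inv B" by (simp add: D_matrix_def B_def P_def)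
  have D_mult: "D_matrix Q \<gamma> *v (d - \<gamma> *\<^sub>R (Q *v d)) = \<gamma> *\<^sub>R (d + \<gamma> *\<^sub>R (Q *v d))" for d
  proof -
    have "matrix_inv B *v (B *v w) = w" for w
      using matrix_inv_inverse(2)[OF inv] by (simp add: matrix_vector_mul_assoc)
    then show ?thesis
      unfolding D scaleR_matrix_vector_assoc[symmetric] B_mult[symmetric] by simp
  qed
  have onto: "\<exists>d. v = d - \<gamma> *\<^sub>R (Q *v d)" for v
  proof -
    have "v = B *v (matrix_inv B *v v)"
      using matrix_inv_inverse(1)[OF inv] by (simp add: matrix_vector_mul_assoc)
    then show ?thesis using B_mult[of "P *v (matrix_inv B *v v)"] unfolding P_right by metis
  qed
  have range: "\<mu> \<le> t" "t \<le> L" "0 < 1 - \<gamma> * t" if "t \<in> eigenvalues Q" for t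
  proof -
    show "\<mu> \<le> t" "t \<le> L"
      using that finite_eigenvalues[OF symQ] by (simp_all add: lambda_min_def lambda_max_def)
    then have "\<gamma> * t \<le> \<gamma> * L" using \<gamma> by simp
    then show "0 < 1 - \<gamma> * t" using step by linarith
  qed
  have "\<phi> t \<in> eigenvalues (D_matrix Q \<gamma>)" if t: "t \<in> eigenvalues Q" for t
  proof -
    obtain v where v: "v \<noteq> 0" "Q *v v = t *\<^sub>R v" using t by (auto simp: eigenvalues_def)
    have "v - \<gamma> *\<^sub>R (Q *v v) = (1 - \<gamma> * t) *\<^sub>R v" "v + \<gamma> *\<^sub>R (Q *v v) = (1 + \<gamma> * t) *\<^sub>R v"
      by (simp_all add: v algebra_simps)
    then have "(1 - \<gamma> * t) *\<^sub>R (D_matrix Q \<gamma> *v v) = (\<gamma> * (1 + \<gamma> * t)) *\<^sub>R v"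
      using D_mult[of v] by (simp add: matrix_vector_mult_scaleR)
    then have "(1 / (1 - \<gamma> * t)) *\<^sub>R ((1 - \<gamma> * t) *\<^sub>R (D_matrix Q \<gamma> *v v)) = \<phi> t *\<^sub>R v"
      by (simp add: \<phi>_def)
    then have "D_matrix Q \<gamma> *v v = \<phi> t *\<^sub>R v" using range(3)[OF t] by simp
    then show ?thesis using v(1) by (auto simp: eigenvalues_def)
  qed
  moreover have "l \<in> \<phi> ` eigenvalues Q" if l: "l \<in> eigenvalues (D_matrix Q \<gamma>)" for l
  proof -
    obtain v where v: "v \<noteq> 0" "D_matrix Q \<gamma> *v v = l *\<^sub>R v" using l by (auto simp: eigenvalues_def)
    obtain d where d: "v = d - \<gamma> *\<^sub>R (Q *v d)" using onto by blast
    have "d \<noteq> 0" using v(1) d by auto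
    have eq: "(\<gamma> * (\<gamma> + l)) *\<^sub>R (Q *v d) = (l - \<gamma>) *\<^sub>R d"
      using D_mult[of d] v(2) unfolding d by (simp add: algebra_simps)
    have "\<gamma> + l \<noteq> 0"
    proof
      assume "\<gamma> + l = 0"
      then have "l - \<gamma> = 0" using eq \<open>d \<noteq> 0\<close> by simp
      with \<open>\<gamma> + l = 0\<close> \<gamma> show False by simp
    qed
    define t where "t = (l - \<gamma>) / (\<gamma> * (\<gamma> + l))"
    have "(1 / (\<gamma> * (\<gamma> + l))) *\<^sub>R ((\<gamma> * (\<gamma> + l)) *\<^sub>R (Q *v d)) = t *\<^sub>R d"
      unfolding eq by (simp add: t_def)
    then have "Q *v d = t *\<^sub>R d" using \<gamma> \<open>\<gamma> + l \<noteq> 0\<close> by simp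
    then have t: "t \<in> eigenvalues Q" using \<open>d \<noteq> 0\<close> by (auto simp: eigenvalues_def)
    have "\<gamma> * t * (\<gamma> + l) = l - \<gamma>" using \<gamma> \<open>\<gamma> + l \<noteq> 0\<close> by (simp add: t_def)
    then have "l * (1 - \<gamma> * t) = \<gamma> * (1 + \<gamma> * t)" by (simp add: algebra_simps)
    then have "l = \<phi> t" using range(3)[OF t] by (simp add: \<phi>_def eq_divide_eq)
    with t show ?thesis by blast
  qed
  ultimately have eig: "eigenvalues (D_matrix Q \<gamma>) = \<phi> ` eigenvalues Q" by blast
  have mu_eig: "\<mu> \<in> eigenvalues Q"
    unfolding lambda_min_def
    by (rule Min_in[OF finite_eigenvalues[OF symQ] eigenvalues_nonempty[OF symQ]])
  show ?thesis unfolding lambda_min_def[of "D_matrix Q \<gamma>"] eig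
  proof (rule Min_eqI)
    show "finite (\<phi> ` eigenvalues Q)" using finite_eigenvalues[OF symQ] by simp
    show "\<delta> \<in> \<phi> ` eigenvalues Q" using mu_eig by (simp add: \<delta>_def \<phi>_def)
    fix l assume "l \<in> \<phi> ` eigenvalues Q"
    then obtain t where t: "t \<in> eigenvalues Q" "l = \<phi> t" by blast
    have "\<gamma> * \<mu> \<le> \<gamma> * t" using range(1)[OF t(1)] \<gamma> by simp
    then show "\<delta> \<le> l" unfolding t(2) \<phi>_def \<delta>_def
      using range(3)[OF t(1)] \<gamma> mu_pos step_mu
      by (intro frac_le mult_left_mono mult_nonneg_nonneg) (auto intro: add_nonneg_nonneg)
  qed
qed

lemma mu_h_eq: "mu_h Q \<gamma> = \<delta> * min_curv"
  by (simp add: mu_h_def lambda_min_D_matrix min_curv_def)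

lemma L_h_ge_1: "1 \<le> L_h Q \<gamma>"
  unfolding L_h_def using \<gamma> L_pos step by (simp add: le_divide_eq)

lemma mu_h_le_1: "mu_h Q \<gamma> \<le> 1"
proof -
  have pos: "0 < 1 + \<gamma> * \<mu>" using \<gamma> mu_pos by (simp add: add_pos_pos)
  have "\<delta> * min_curv \<le> \<delta> * ((1 - \<gamma> * \<mu>) * \<mu> / (1 + \<gamma> * \<mu>)\<^sup>2)"
    using delta_pos by (intro mult_left_mono) (simp_all add: min_curv_def)
  also have "\<dots> = \<gamma> * \<mu> / (1 + \<gamma> * \<mu>)"
    using pos step_mu by (simp add: \<delta>_def power2_eq_square)
  also have "\<dots> \<le> 1" using pos by (simp add: divide_le_eq)
  finally show ?thesis by (simp add: mu_h_eq)
qed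

lemma gamma_le_delta: "\<gamma> \<le> \<delta>"
proof -
  have "0 < \<gamma> * \<mu>" using \<gamma> mu_pos by simp
  then have "\<gamma> * (1 - \<gamma> * \<mu>) \<le> \<gamma> * (1 + \<gamma> * \<mu>)" using \<gamma> by (intro mult_left_mono) auto
  then show ?thesis using step_mu by (simp add: \<delta>_def pos_le_divide_eq)
qed

text \<open>The quantity that Nesterov's estimate subtracts from \<open>\<psi>(u)\<close>, on the left, is at most the gap between \<open>F(z)\<close>
  and \<open>\<psi>(u)\<close> that \<open>F_bwd_le\<close> guarantees, on the right.\<close>

lemma M_over_L_h_le: "1 / (2 * L_h Q \<gamma>) * (a \<bullet> M a) \<le> (1 - \<gamma> * L) / (2 * \<gamma>) * (norm a)\<^sup>2"
proof -
  have gL: "0 < \<gamma> * L" using \<gamma> L_pos by simp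
  have "1 / L_h Q \<gamma> = (1 - \<gamma> * L) / (1 + \<gamma> * L)" by (simp add: L_h_def)
  also have "\<dots> \<le> (1 - \<gamma> * L) / 1" using gL step by (intro divide_left_mono) auto
  finally have "1 / L_h Q \<gamma> \<le> 1 - \<gamma> * L" by simp
  moreover have "a \<bullet> M a \<le> (norm a)\<^sup>2 / \<gamma>"
    using order_trans[OF mult_right_mono[OF gamma_le_delta M_pos] M_le, of a] \<gamma>
    by (simp add: power2_norm_eq_inner pos_le_divide_eq mult.commute)
  ultimately have "1 / L_h Q \<gamma> * (a \<bullet> M a) \<le> (1 - \<gamma> * L) * ((norm a)\<^sup>2 / \<gamma>)"
    using step M_pos by (intro mult_mono) auto
  then show ?thesis by simp
qed

text \<open>With \<open>l = 1 / L\<^sub>h \<le> 1\<close> the 1-smooth envelope decreases by \<open>(l - l^2/2) |r|\<^sub>M^2 \<ge> l/2 |r|\<^sub>M^2\<close>.\<close>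

lemma envelope_descent:
  "envelope (u - (1 / L_h Q \<gamma>) *\<^sub>R (fwd u - bwd u))
    \<le> envelope u - 1 / (2 * L_h Q \<gamma>) * ((fwd u - bwd u) \<bullet> M (fwd u - bwd u))"
proof -
  define r where "r = fwd u - bwd u"
  define l where "l = 1 / L_h Q \<gamma>"
  have l: "0 \<le> l" "l \<le> 1" using L_h_ge_1 by (simp_all add: l_def)
  have "envelope (u - l *\<^sub>R r) \<le> envelope u - l * (r \<bullet> M r) + 1 / 2 * (l * l * (r \<bullet> M r))"
    using envelope_smooth[of "u - l *\<^sub>R r" u] linear_scale[OF linear_M, of "- l" r]
    unfolding r_def[symmetric] by simp
  moreover have "l * l * (r \<bullet> M r) \<le> l * (r \<bullet> M r)"
    using l M_pos by (intro mult_right_mono mult_left_le) auto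
  moreover have "1 / (2 * L_h Q \<gamma>) * (r \<bullet> M r) = 1 / 2 * (l * (r \<bullet> M r))" by (simp add: l_def)
  ultimately show ?thesis unfolding r_def[symmetric] l_def[symmetric] by linarith
qed

lemma accelerated_rate:
  fixes x u :: "nat \<Rightarrow> real^'n"
  assumes "u 0 = x 0"
    and "\<And>k. x (Suc k) = u k - (1 / L_h Q \<gamma>) *\<^sub>R (fwd (u k) - bwd (u k))"
    and "\<And>k. u (Suc k) = x (Suc k)
      + ((1 - sqrt (mu_h Q \<gamma> / L_h Q \<gamma>)) / (1 + sqrt (mu_h Q \<gamma> / L_h Q \<gamma>))) *\<^sub>R (x (Suc k) - x k)"
    and fixed: "bwd xs = fwd xs"
  shows "quadratic Q q (bwd (u k)) + real_of_ereal (g (bwd (u k))) - envelope xs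
    \<le> L_h Q \<gamma> / \<delta> * (1 - sqrt (mu_h Q \<gamma> / L_h Q \<gamma>)) ^ k * (norm (x 0 - xs))\<^sup>2"
proof -
  define \<alpha> where "\<alpha> = sqrt (mu_h Q \<gamma> / L_h Q \<gamma>)"
  have mu_h: "0 < mu_h Q \<gamma>" using delta_pos min_curv_pos by (simp add: mu_h_eq)
  have le: "mu_h Q \<gamma> \<le> L_h Q \<gamma>" using mu_h_le_1 L_h_ge_1 by linarith
  have \<alpha>: "0 \<le> \<alpha>" "\<alpha> \<le> 1" using mu_h le L_h_ge_1 by (simp_all add: \<alpha>_def)
  have "quadratic Q q (bwd (u k)) + real_of_ereal (g (bwd (u k))) - envelope xs
      \<le> envelope (u k) - 1 / (2 * L_h Q \<gamma>) * ((fwd (u k) - bwd (u k)) \<bullet> M (fwd (u k) - bwd (u k))) - envelope xs"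
    using F_bwd_le[of "u k"] M_over_L_h_le[of "fwd (u k) - bwd (u k)"] by linarith
  also have "\<dots> \<le> (1 - \<alpha>) ^ Suc k
      * (envelope (x 0) - envelope xs + mu_h Q \<gamma> / 2 * ((x 0 - xs) \<bullet> M (x 0 - xs)))"
    unfolding \<alpha>_def
  proof (rule nesterov_accelerated_descent[where r = "\<lambda>k. fwd (u k) - bwd (u k)",
        OF linear_M M_sym M_pos mu_h le assms(1-3)])
    fix j v
    show "envelope (u j) + (fwd (u j) - bwd (u j)) \<bullet> M (v - u j)
        + mu_h Q \<gamma> / 2 * ((v - u j) \<bullet> M (v - u j)) \<le> envelope v"
      unfolding mu_h_eq by (rule envelope_strongly_convex)
    show "envelope (x (Suc j)) \<le> envelope (u j)
        - 1 / (2 * L_h Q \<gamma>) * ((fwd (u j) - bwd (u j)) \<bullet> M (fwd (u j) - bwd (u j)))"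
      unfolding assms(2) by (rule envelope_descent)
  qed
  also have "\<dots> \<le> (1 - \<alpha>) ^ k * (L_h Q \<gamma> / \<delta> * (norm (x 0 - xs))\<^sup>2)"
  proof (rule mult_mono)
    define X where "X = (x 0 - xs) \<bullet> M (x 0 - xs)"
    have X: "0 \<le> X" "\<delta> * X \<le> (norm (x 0 - xs))\<^sup>2"
      using M_pos M_le by (simp_all add: X_def power2_norm_eq_inner)
    have "envelope (x 0) - envelope xs \<le> 1 / 2 * X"
      using envelope_smooth[of "x 0" xs] fixed by (simp add: X_def)
    moreover have "mu_h Q \<gamma> * X \<le> 1 * X" using mu_h_le_1 X(1) by (intro mult_right_mono)
    ultimately have "envelope (x 0) - envelope xs + mu_h Q \<gamma> / 2 * X \<le> 1 * X" by simp
    also have "\<dots> \<le> L_h Q \<gamma> * X" using L_h_ge_1 X(1) by (intro mult_right_mono)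
    also have "\<dots> \<le> L_h Q \<gamma> * ((norm (x 0 - xs))\<^sup>2 / \<delta>)"
      using X(2) delta_pos L_h_ge_1 by (intro mult_left_mono) (simp_all add: pos_le_divide_eq mult.commute)
    finally show "envelope (x 0) - envelope xs + mu_h Q \<gamma> / 2 * ((x 0 - xs) \<bullet> M (x 0 - xs))
        \<le> L_h Q \<gamma> / \<delta> * (norm (x 0 - xs))\<^sup>2" by (simp add: X_def)
    show "(1 - \<alpha>) ^ Suc k \<le> (1 - \<alpha>) ^ k" using \<alpha> by (intro power_decreasing) auto
    show "0 \<le> (1 - \<alpha>) ^ k" using \<alpha> by simp
    have "envelope xs \<le> envelope (x 0)"
      using envelope_strongly_convex[of xs "x 0"] fixed mu_h X(1) unfolding X_def mu_h_eq
      by simp (smt (verit) divide_nonneg_nonneg mult_nonneg_nonneg)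
    then show "0 \<le> envelope (x 0) - envelope xs + mu_h Q \<gamma> / 2 * ((x 0 - xs) \<bullet> M (x 0 - xs))"
      using mu_h X(1) by (simp add: X_def)
  qed
  finally show ?thesis unfolding \<alpha>_def by (simp add: mult_ac)
qed

end

theorem theorem6:
  fixes Q :: "real^'n^'n" and q :: "real^'n"
    and f g F :: "real^'n \<Rightarrow> ereal"
    and \<gamma> :: real and lam \<beta> :: "nat \<Rightarrow> real"
    and x y z u :: "nat \<Rightarrow> real^'n" and xt :: "real^'n"
  assumes "symmetric_matrix Q" and "pos_semidef Q"
    and "lambda_min Q > 0"
    and "f = (\<lambda>v. ereal (quadratic Q q v))"
    and "proper_fun g" and "closed_fun g" and "convex_fun g"
    and "F = (\<lambda>v. f v + g v)"
    and "minimizers F \<noteq> {}"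
    and "0 < \<gamma>" and "\<gamma> < 1 / lambda_max Q"
    and "\<And>k. lam k = (1 - \<gamma> * lambda_max Q) / (1 + \<gamma> * lambda_max Q)"
    and "\<And>k. \<beta> k = (1 - sqrt (mu_h Q \<gamma> / L_h Q \<gamma>)) / (1 + sqrt (mu_h Q \<gamma> / L_h Q \<gamma>))"
    and "u 0 = x 0"
    and "\<And>k. y k = prox \<gamma> f (u k)"
    and "\<And>k. z k = prox \<gamma> g (2 *\<^sub>R y k - u k)"
    and "\<And>k. x (Suc k) = u k + lam k *\<^sub>R (z k - y k)"
    and "\<And>k. u (Suc k) = x (Suc k) + \<beta> k *\<^sub>R (x (Suc k) - x k)"
    and "xt \<in> DR_fixed_points \<gamma> f g"
  shows "\<forall>k. F (z k) - min_value F
    \<le> ereal (L_h Q \<gamma> / lambda_min (D_matrix Q \<gamma>)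
        * (1 - sqrt (mu_h Q \<gamma> / L_h Q \<gamma>)) ^ k * (norm (x 0 - xt))\<^sup>2)"
proof
  fix k
  note sym = assms(1) and mu_pos = assms(3) and f = assms(4) and F = assms(8) and \<gamma> = assms(10)
  have "0 < lambda_max Q" using lambda_min_le_lambda_max[OF sym] mu_pos by linarith
  with assms(11) have "\<gamma> * lambda_max Q < 1" by (simp add: pos_less_divide_eq)
  then interpret quadratic_DR Q q g \<gamma>
    using sym mu_pos \<gamma> assms(5-7) by unfold_locales
  have y: "y k = fwd (u k)" and z: "z k = bwd (u k)" for k
    using assms(15,16)[of k] by (simp_all add: f prox_f bwd_def)
  have fixed: "bwd xt = fwd xt"
    using assms(19) by (simp add: DR_fixed_points_def f prox_f bwd_def)
  have lam: "lam k = 1 / L_h Q \<gamma>" for k by (simp add: assms(12) L_h_def)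
  have x_step: "x (Suc k) = u k - (1 / L_h Q \<gamma>) *\<^sub>R (fwd (u k) - bwd (u k))" for k
    unfolding assms(17) lam y z by (simp add: algebra_simps)
  have rate: "quadratic Q q (z k) + real_of_ereal (g (z k)) - envelope xt
    \<le> L_h Q \<gamma> / \<delta> * (1 - sqrt (mu_h Q \<gamma> / L_h Q \<gamma>)) ^ k * (norm (x 0 - xt))\<^sup>2"
    unfolding z using assms(14) x_step assms(18)[unfolded assms(13)] fixed by (rule accelerated_rate)
  have "ereal (envelope xt) \<le> min_value F"
    unfolding min_value_def F f by (intro INF_greatest envelope_fixed_point_le fixed)
  then have "ereal t - min_value F \<le> ereal t - ereal (envelope xt)" for t
    by (intro ereal_minus_mono) auto
  moreover have "F (z k) = ereal (quadratic Q q (z k) + real_of_ereal (g (z k)))"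
    using prox_variational(1)[OF assms(5-7) \<gamma>, of "2 *\<^sub>R fwd (u k) - u k"]
    unfolding F f bwd_def[symmetric] z by (metis plus_ereal.simps(1))
  ultimately have "F (z k) - min_value F
      \<le> ereal (quadratic Q q (z k) + real_of_ereal (g (z k))) - ereal (envelope xt)"
    by simp
  also have "\<dots> \<le> ereal (L_h Q \<gamma> / lambda_min (D_matrix Q \<gamma>)
        * (1 - sqrt (mu_h Q \<gamma> / L_h Q \<gamma>)) ^ k * (norm (x 0 - xt))\<^sup>2)"
    using rate by (simp add: lambda_min_D_matrix)
  finally show "F (z k) - min_value F \<le> ereal (L_h Q \<gamma> / lambda_min (D_matrix Q \<gamma>)
        * (1 - sqrt (mu_h Q \<gamma> / L_h Q \<gamma>)) ^ k * (norm (x 0 - xt))\<^sup>2)" .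
qed

end
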